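(* Let $G$ be a pro-oligomorphic group, let $k$ be a field of positive characteristic $p$, let $\mu$ be a $k$-valued measure for $G$, and let $X$ be a finitary $\hat G$-set. If $A\in\mathrm{Mat}_X(k)$ is nilpotent, then $\mathrm{tr}(A)=0$.
   Context: A pro-oligomorphic group is a topological group $G$ that is Hausdorff, non-archimedean (its open subgroups form a neighborhood basis of the identity), and Roelcke precompact (in the presence of the previous condition: $U\backslash G/V$ is finite for all open subgroups $U,V$). A $G$-set is a set with a smooth action of $G$, i.e. every stabilizer is open (same convention for open subgroups). A set with a group action is finitary if it has finitely many orbits. A $\hat G$-set is a set $X$ with a smooth action of some open subgroup $U$ of $G$ (a group of definition), where shrinking $U$ does not change the $\hat G$-set; it is finitary if $U$ has finitely many orbits on $X$ (independent of $U$). Maps of $\hat G$-sets are functions equivariant for some common open group of definition. For $g\in G$, $X^g$ is the same set with action $h\bullet x=(g^{-1}hg)\cdot x$. A measure for $G$ with values in a commutative ring $k$ is a rule $\mu$ assigning to each finitary $\hat G$-set $X$ an element $\mu(X)\in k$ such that: (a) $\mu(X)=\mu(Y)$ if $X\cong Y$; (b) $\mu$ of a one-point set is $1$; (c) $\mu(X\amalg Y)=\mu(X)+\mu(Y)$; (d) $\mu(X^g)=\mu(X)$; (e) if $U$ is an open subgroup and $X\to Y$ is a map of transitive $U$-sets with fiber $F$ over some point, then $\mu(X)=\mu(F)\mu(Y)$. A Schwartz function on a $\hat G$-set $X$ is a function $\phi\colon X\to k$ that is invariant under some group of definition of $X$ and whose support is a finitary $\hat G$-set; such $\phi$ takes finitely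 many non-zero values $c_1,\dots,c_n$, and $\int_X\phi(x)\,dx=\sum_i c_i\,\mu(\phi^{-1}(c_i))$. For a finitary $\hat G$-set $X$, $\mathrm{Mat}_X(k)$ is the set of Schwartz functions $A\colon X\times X\to k$; it is an associative unital $k$-algebra under $(AB)(x,z)=\int_X A(x,y)B(y,z)\,dy$, and $\mathrm{tr}(A)=\int_X A(x,x)\,dx$. *)

theory Defs
  imports "HOL-Analysis.Analysis" "HOL-Algebra.Group_Action" "HOL-Algebra.Ring"
begin

section \<open>Pro-oligomorphic groups\<close>

locale topological_group = group G for G (structure) +
  fixes T :: "'g topology"
  assumes topspace_eq: "topspace T = carrier G"
    and continuous_mult: "continuous_map (prod_topology T T) T (\<lambda>(x, y). x \<otimes> y)"
    and continuous_inv: "continuous_map T T (\<lambda>x. inv x)"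

definition open_subgroup :: "('g, 'm) monoid_scheme \<Rightarrow> 'g topology \<Rightarrow> 'g set \<Rightarrow> bool" where
  "open_subgroup G T U \<longleftrightarrow> subgroup U G \<and> openin T U"

locale pro_oligomorphic = topological_group +
  assumes Hausdorff: "Hausdorff_space T"
    and non_archimedean:
      "\<lbrakk>openin T N; \<one> \<in> N\<rbrakk> \<Longrightarrow> \<exists>U. open_subgroup G T U \<and> U \<subseteq> N"
    and Roelcke_precompact:
      "\<lbrakk>open_subgroup G T U; open_subgroup G T V\<rbrakk> \<Longrightarrow> finite {U <#> (g <# V) | g. g \<in> carrier G}"

section \<open>Sets with a smooth action of an open subgroup\<close>

text \<open>
  A \<open>G\<close>-hat set is presented by its points, one group of definition and the action of that group.
  Presentations that differ by shrinking the group of definition stand for the same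
  \<open>G\<close>-hat set; they are identified by \<open>hat_iso\<close> below, via the identity map.
  The action of a group element is, as in the locale \<open>group_action\<close>, an extensional
  function on the set of points.
\<close>

record ('g, 'x) hat_set =
  points :: "'x set"
  defgrp :: "'g set"
  act :: "'g \<Rightarrow> 'x \<Rightarrow> 'x"

definition is_hat_set :: "('g, 'm) monoid_scheme \<Rightarrow> 'g topology \<Rightarrow> ('g, 'x) hat_set \<Rightarrow> bool" where
  "is_hat_set G T X \<longleftrightarrow>
     open_subgroup G T (defgrp X) \<and>
     group_action (G\<lparr>carrier := defgrp X\<rparr>) (points X) (act X) \<and>
     (\<forall>x \<in> points X. openin T (stabilizer (G\<lparr>carrier := defgrp X\<rparr>) (act X) x))"

definition finitary_hat_set :: "('g, 'm) monoid_scheme \<Rightarrow> 'g topology \<Rightarrow> ('g, 'x) hat_set \<Rightarrow> bool" where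
  "finitary_hat_set G T X \<longleftrightarrow>
     is_hat_set G T X \<and> finite (orbits (G\<lparr>carrier := defgrp X\<rparr>) (points X) (act X))"

definition transitive_hat_set :: "('g, 'm) monoid_scheme \<Rightarrow> 'g topology \<Rightarrow> ('g, 'x) hat_set \<Rightarrow> bool" where
  "transitive_hat_set G T X \<longleftrightarrow>
     is_hat_set G T X \<and> points X \<noteq> {} \<and>
     transitive_action (G\<lparr>carrier := defgrp X\<rparr>) (points X) (act X)"

definition equivariant :: "'g set \<Rightarrow> ('g, 'x) hat_set \<Rightarrow> ('g, 'y) hat_set \<Rightarrow> ('x \<Rightarrow> 'y) \<Rightarrow> bool" where
  "equivariant V X Y f \<longleftrightarrow>
     f \<in> points X \<rightarrow> points Y \<and> (\<forall>g \<in> V. \<forall>x \<in> points X. f (act X g x) = act Y g (f x))"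

definition hat_map ::
  "('g, 'm) monoid_scheme \<Rightarrow> 'g topology \<Rightarrow> ('g, 'x) hat_set \<Rightarrow> ('g, 'y) hat_set \<Rightarrow> ('x \<Rightarrow> 'y) \<Rightarrow> bool"
  where "hat_map G T X Y f \<longleftrightarrow>
     (\<exists>V. open_subgroup G T V \<and> V \<subseteq> defgrp X \<inter> defgrp Y \<and> equivariant V X Y f)"

definition hat_iso ::
  "('g, 'm) monoid_scheme \<Rightarrow> 'g topology \<Rightarrow> ('g, 'x) hat_set \<Rightarrow> ('g, 'y) hat_set \<Rightarrow> bool" where
  "hat_iso G T X Y \<longleftrightarrow> (\<exists>f. hat_map G T X Y f \<and> bij_betw f (points X) (points Y))"

definition hat_sub :: "('g, 'x) hat_set \<Rightarrow> 'g set \<Rightarrow> 'x set \<Rightarrow> ('g, 'x) hat_set" where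
  "hat_sub X V S = \<lparr>points = S, defgrp = V, act = (\<lambda>g. restrict (act X g) S)\<rparr>"

text \<open>The coproduct, for summands whose sets of points are already disjoint.\<close>

definition hat_coprod :: "('g, 'x) hat_set \<Rightarrow> ('g, 'x) hat_set \<Rightarrow> ('g, 'x) hat_set" where
  "hat_coprod X Y =
     \<lparr>points = points X \<union> points Y,
      defgrp = defgrp X \<inter> defgrp Y,
      act = (\<lambda>g. \<lambda>x \<in> points X \<union> points Y. if x \<in> points X then act X g x else act Y g x)\<rparr>"

definition hat_prod :: "('g, 'x) hat_set \<Rightarrow> ('g, 'y) hat_set \<Rightarrow> ('g, 'x \<times> 'y) hat_set" where
  "hat_prod X Y =
     \<lparr>points = points X \<times> points Y,
      defgrp = defgrp X \<inter> defgrp Y,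
      act = (\<lambda>g. \<lambda>(x, y) \<in> points X \<times> points Y. (act X g x, act Y g y))\<rparr>"

definition hat_conj :: "('g, 'm) monoid_scheme \<Rightarrow> 'g \<Rightarrow> ('g, 'x) hat_set \<Rightarrow> ('g, 'x) hat_set" where
  "hat_conj G g X =
     \<lparr>points = points X,
      defgrp = (\<lambda>h. g \<otimes>\<^bsub>G\<^esub> h \<otimes>\<^bsub>G\<^esub> inv\<^bsub>G\<^esub> g) ` defgrp X,
      act = (\<lambda>h. act X (inv\<^bsub>G\<^esub> g \<otimes>\<^bsub>G\<^esub> h \<otimes>\<^bsub>G\<^esub> g))\<rparr>"

section \<open>Measures\<close>

text \<open>
  HOL has no class of all sets, so a measure is a function on the finitary \<open>G\<close>-hat sets
  whose points lie in a fixed type \<open>'x\<close>.  If the type contains a copy of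
  \<open>\<nat> \<times> Pow (carrier G)\<close>, as expressed by \<open>large_universe\<close>, then every finitary
  \<open>G\<close>-hat set is isomorphic to one with points in \<open>'x\<close>, namely to a finite disjoint
  union of coset spaces \<open>U/V\<close>; by invariance under isomorphism such a
  function is then the same thing as a measure on all finitary \<open>G\<close>-hat sets.
\<close>

definition large_universe :: "('g, 'm) monoid_scheme \<Rightarrow> 'x itself \<Rightarrow> bool" where
  "large_universe G _ \<longleftrightarrow>
     (\<exists>\<iota> :: nat \<times> 'g set \<Rightarrow> 'x. inj_on \<iota> (UNIV \<times> Pow (carrier G)))"

locale hat_measure =
  fixes G :: "('g, 'm) monoid_scheme" (structure)
    and T :: "'g topology"
    and \<mu> :: "('g, 'x) hat_set \<Rightarrow> 'k::comm_ring_1"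
  assumes iso_invariant:
      "\<lbrakk>finitary_hat_set G T X; finitary_hat_set G T Y; hat_iso G T X Y\<rbrakk> \<Longrightarrow> \<mu> X = \<mu> Y"
    and one_point:
      "\<lbrakk>is_hat_set G T X; points X = {x}\<rbrakk> \<Longrightarrow> \<mu> X = 1"
    and additive:
      "\<lbrakk>finitary_hat_set G T X; finitary_hat_set G T Y; points X \<inter> points Y = {}\<rbrakk>
        \<Longrightarrow> \<mu> (hat_coprod X Y) = \<mu> X + \<mu> Y"
    and conj_invariant:
      "\<lbrakk>finitary_hat_set G T X; g \<in> carrier G\<rbrakk> \<Longrightarrow> \<mu> (hat_conj G g X) = \<mu> X"
    and fibration:
      "\<lbrakk>transitive_hat_set G T X; transitive_hat_set G T Y; defgrp X = U; defgrp Y = U;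
        equivariant U X Y f; y \<in> points Y\<rbrakk>
        \<Longrightarrow> \<mu> X = \<mu> (hat_sub X (stabilizer (G\<lparr>carrier := U\<rparr>) (act Y) y)
                       {x \<in> points X. f x = y}) * \<mu> Y"

section \<open>Schwartz functions and integration\<close>

definition invariant_under :: "'g set \<Rightarrow> ('g, 'x) hat_set \<Rightarrow> ('x \<Rightarrow> 'k) \<Rightarrow> bool" where
  "invariant_under V X \<phi> \<longleftrightarrow> (\<forall>g \<in> V. \<forall>x \<in> points X. \<phi> (act X g x) = \<phi> x)"

definition schwartz ::
  "('g, 'm) monoid_scheme \<Rightarrow> 'g topology \<Rightarrow> ('g, 'x) hat_set \<Rightarrow> ('x \<Rightarrow> 'k::zero) \<Rightarrow> bool" where
  "schwartz G T X \<phi> \<longleftrightarrow>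
     (\<exists>V. open_subgroup G T V \<and> V \<subseteq> defgrp X \<and> invariant_under V X \<phi> \<and>
          finitary_hat_set G T (hat_sub X V {x \<in> points X. \<phi> x \<noteq> 0}))"

text \<open>
  The level sets of a Schwartz function need a group of definition.  Any open subgroup leaving
  the function invariant will do, and up to \<open>hat_iso\<close> the choice does not matter; the
  integral uses the largest one.
\<close>

definition invariance_group :: "('g, 'x) hat_set \<Rightarrow> ('x \<Rightarrow> 'k) \<Rightarrow> 'g set" where
  "invariance_group X \<phi> = {g \<in> defgrp X. \<forall>x \<in> points X. \<phi> (act X g x) = \<phi> x}"

definition hat_integral ::
  "(('g, 'x) hat_set \<Rightarrow> 'k) \<Rightarrow> ('g, 'x) hat_set \<Rightarrow> ('x \<Rightarrow> 'k::comm_ring_1) \<Rightarrow> 'k" where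
  "hat_integral \<mu> X \<phi> =
     (\<Sum>c \<in> \<phi> ` points X - {0}.
        c * \<mu> (hat_sub X (invariance_group X \<phi>) {x \<in> points X. \<phi> x = c}))"

section \<open>The matrix algebra\<close>

definition Mat ::
  "('g, 'm) monoid_scheme \<Rightarrow> 'g topology \<Rightarrow> (('g, 'x) hat_set \<Rightarrow> 'k) \<Rightarrow> ('g, 'x) hat_set
    \<Rightarrow> ('x \<times> 'x \<Rightarrow> 'k::comm_ring_1) ring" where
  "Mat G T \<mu> X =
     \<lparr>carrier = {A \<in> extensional (points X \<times> points X). schwartz G T (hat_prod X X) A},
      mult = (\<lambda>A B. \<lambda>(x, z) \<in> points X \<times> points X.
                hat_integral \<mu> X (\<lambda>y. A (x, y) * B (y, z))),
      one = (\<lambda>(x, y) \<in> points X \<times> points X. if x = y then 1 else 0),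
      zero = (\<lambda>(x, y) \<in> points X \<times> points X. 0),
      add = (\<lambda>A B. \<lambda>(x, y) \<in> points X \<times> points X. A (x, y) + B (x, y))\<rparr>"

definition mat_trace ::
  "(('g, 'x) hat_set \<Rightarrow> 'k) \<Rightarrow> ('g, 'x) hat_set \<Rightarrow> ('x \<times> 'x \<Rightarrow> 'k::comm_ring_1) \<Rightarrow> 'k" where
  "mat_trace \<mu> X A = hat_integral \<mu> X (\<lambda>x. A (x, x))"

definition nilpotent :: "('a, 'm) ring_scheme \<Rightarrow> 'a \<Rightarrow> bool" where
  "nilpotent R a \<longleftrightarrow> (\<exists>n::nat. a [^]\<^bsub>R\<^esub> n = \<zero>\<^bsub>R\<^esub>)"

end

theory Submission
  imports Defs
begin

text \<open>
  The result is a Frobenius identity: in characteristic \<open>p\<close>, with \<open>q\<close> a power of \<open>p\<close>,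
  the trace of \<open>A\<^sup>q\<close> is the \<open>q\<close>-th power of the trace of \<open>A\<close> (\<open>mat_trace_frobenius\<close>).
  If \<open>A\<close> is nilpotent and \<open>q\<close> is large, the left-hand side is the trace of zero, so a power of the trace of \<open>A\<close> vanishes, and \<open>k\<close> is a field.

  Both sides are integrals over \<open>q\<close>-tuples of points of \<open>X\<close>.  Iterating the definition of the matrix
  product turns the left-hand side into the integral of
  \<open>A(x\<^sub>1,x\<^sub>2) A(x\<^sub>2,x\<^sub>3) \<dots> A(x\<^sub>q,x\<^sub>1)\<close>, up to the order of the indices, and the right-hand side is
  the integral of \<open>A(x\<^sub>1,x\<^sub>1) \<dots> A(x\<^sub>q,x\<^sub>q)\<close>.  The two integrands differ, but both are invariant under
  cyclic rotation of the tuple and they agree on constant tuples.  An integral of a rotation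
  invariant function only sees the constant tuples (\<open>action_integral_rotation_invariant\<close>): the
  map from the non-constant tuples to their rotation classes has finite fibers, each of cardinality
  a power of \<open>p\<close> other than \<open>1\<close>, on which the integrand is constant; so each fiber contributes zero
  and Fubini's theorem finishes the argument.

  Fubini's theorem (\<open>action_integral_fubini\<close>) is the fibration axiom of a measure, applied orbit by
  orbit.  It needs sets of tuples and sets of rotation classes, whose types differ from the type
  of the points of \<open>X\<close>.  The measure is therefore first extended to finitary actions on sets of any
  type: such a set injects into a large enough type, and invariance under isomorphism makes the
  choice of injection immaterial.
\<close>

section \<open>Orbits and stabilizers\<close>

definition orb :: "'g set \<Rightarrow> ('g \<Rightarrow> 'y \<Rightarrow> 'y) \<Rightarrow> 'y \<Rightarrow> 'y set" where
  "orb V a y = (\<lambda>g. a g y) ` V"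

definition stab :: "'g set \<Rightarrow> ('g \<Rightarrow> 'y \<Rightarrow> 'y) \<Rightarrow> 'y \<Rightarrow> 'g set" where
  "stab V a y = {g \<in> V. a g y = y}"

lemma finite_image_factor:
  assumes "finite (f ` A)" and "\<And>x y. \<lbrakk>x \<in> A; y \<in> A; f x = f y\<rbrakk> \<Longrightarrow> g x = g y"
  shows "finite (g ` A)"
proof -
  have "g ` A \<subseteq> (\<lambda>z. g (inv_into A f z)) ` (f ` A)"
  proof
    fix w assume "w \<in> g ` A"
    then obtain x where x: "x \<in> A" "w = g x" by blast
    have "g (inv_into A f (f x)) = g x"
      using x by (intro assms(2)) (auto simp: f_inv_into_f inv_into_into)
    then show "w \<in> (\<lambda>z. g (inv_into A f z)) ` (f ` A)" using x by force
  qed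
  then show ?thesis using assms(1) by (meson finite_imageI finite_subset)
qed

section \<open>Open subgroups\<close>

context topological_group
begin

abbreviation osub :: "'g set \<Rightarrow> bool" where "osub \<equiv> open_subgroup G T"

lemma osub_subgroup: "osub V \<Longrightarrow> subgroup V G"
  by (simp add: open_subgroup_def)

lemma osub_one: "osub V \<Longrightarrow> \<one> \<in> V"
  by (simp add: open_subgroup_def subgroup.one_closed)

lemma osub_mult: "\<lbrakk>osub V; g \<in> V; h \<in> V\<rbrakk> \<Longrightarrow> g \<otimes> h \<in> V"
  by (simp add: open_subgroup_def subgroup.m_closed)

lemma osub_inv: "\<lbrakk>osub V; g \<in> V\<rbrakk> \<Longrightarrow> inv g \<in> V"
  by (simp add: open_subgroup_def subgroup.m_inv_closed)

lemma osub_carrier: "\<lbrakk>osub V; g \<in> V\<rbrakk> \<Longrightarrow> g \<in> carrier G"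
  by (meson open_subgroup_def subgroup.mem_carrier)

lemma continuous_translation:
  assumes "g \<in> carrier G" "h \<in> carrier G"
  shows "continuous_map T T (\<lambda>x. g \<otimes> x \<otimes> h)"
proof -
  have l: "continuous_map T T (\<lambda>x. g \<otimes> x)"
  proof -
    have "continuous_map T (prod_topology T T) (\<lambda>x. (g, x))"
      using assms by (simp add: continuous_map_pairwise o_def topspace_eq)
    from continuous_map_compose[OF this continuous_mult] show ?thesis by (simp add: o_def)
  qed
  have r: "continuous_map T T (\<lambda>x. x \<otimes> h)"
  proof -
    have "continuous_map T (prod_topology T T) (\<lambda>x. (x, h))"
      using assms by (simp add: continuous_map_pairwise o_def topspace_eq)
    from continuous_map_compose[OF this continuous_mult] show ?thesis by (simp add: o_def)
  qed
  from continuous_map_compose[OF l r] show ?thesis by (simp add: o_def)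
qed

lemma open_translation_vimage:
  assumes "openin T W" "g \<in> carrier G" "h \<in> carrier G"
  shows "openin T {x \<in> carrier G. g \<otimes> x \<otimes> h \<in> W}"
  using openin_continuous_map_preimage[OF continuous_translation[OF assms(2,3)] assms(1)]
  by (simp add: topspace_eq)

text \<open>
  A subgroup containing an open subgroup is a union of its cosets.  This is how stabilizers are shown
  to be open without describing them exactly.
\<close>

lemma open_subgroup_mono:
  assumes W: "osub W" and H: "subgroup H G" and WH: "W \<subseteq> H"
  shows "osub H"
proof -
  have "openin T H"
  proof (subst openin_subopen, intro ballI)
    fix h assume h: "h \<in> H"
    let ?N = "{x \<in> carrier G. inv h \<otimes> x \<otimes> \<one> \<in> W}"
    have hc: "h \<in> carrier G" using H h by (rule subgroup.mem_carrier)
    have "openin T ?N"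
      using W hc by (intro open_translation_vimage) (auto simp: open_subgroup_def)
    moreover have "h \<in> ?N" using hc osub_one[OF W] by simp
    moreover have "?N \<subseteq> H"
    proof
      fix x assume x: "x \<in> ?N"
      then have "inv h \<otimes> x \<in> H" using WH hc by auto
      then have "h \<otimes> (inv h \<otimes> x) \<in> H" using H h by (simp add: subgroup.m_closed)
      then show "x \<in> H" using hc x by (simp add: m_assoc[symmetric])
    qed
    ultimately show "\<exists>N. openin T N \<and> h \<in> N \<and> N \<subseteq> H" by blast
  qed
  then show ?thesis using H by (simp add: open_subgroup_def)
qed

lemma osub_Int: "\<lbrakk>osub V; osub W\<rbrakk> \<Longrightarrow> osub (V \<inter> W)"
  by (simp add: open_subgroup_def subgroups_Inter_pair openin_Int)

lemma conj_inverse: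
  assumes "g \<in> carrier G" "h \<in> carrier G"
  shows "inv g \<otimes> (g \<otimes> h \<otimes> inv g) \<otimes> g = h" "g \<otimes> (inv g \<otimes> h \<otimes> g) \<otimes> inv g = h"
  using assms by (simp_all add: m_assoc) (simp_all add: m_assoc[symmetric])

lemma osub_conj:
  assumes W: "osub W" and g: "g \<in> carrier G"
  shows "osub ((\<lambda>h. g \<otimes> h \<otimes> inv g) ` W)"
proof -
  let ?C = "(\<lambda>h. g \<otimes> h \<otimes> inv g) ` W"
  have eq: "?C = {x \<in> carrier G. inv g \<otimes> x \<otimes> g \<in> W}"
  proof (intro Set.set_eqI iffI)
    fix x assume "x \<in> ?C"
    then show "x \<in> {x \<in> carrier G. inv g \<otimes> x \<otimes> g \<in> W}"
      using g osub_carrier[OF W] by (auto simp: conj_inverse)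
  next
    fix x assume x: "x \<in> {x \<in> carrier G. inv g \<otimes> x \<otimes> g \<in> W}"
    then have "x = g \<otimes> (inv g \<otimes> x \<otimes> g) \<otimes> inv g" using g by (simp add: conj_inverse)
    then show "x \<in> ?C" using x by blast
  qed
  have "subgroup ?C G"
  proof (rule subgroupI)
    show "?C \<subseteq> carrier G" using eq by auto
    show "?C \<noteq> {}" using osub_one[OF W] by auto
  next
    fix x assume "x \<in> ?C"
    then obtain h where h: "h \<in> W" "x = g \<otimes> h \<otimes> inv g" by auto
    then have "inv x = g \<otimes> inv h \<otimes> inv g"
      using g osub_carrier[OF W] by (simp add: inv_mult_group m_assoc)
    then show "inv x \<in> ?C" using osub_inv[OF W] h by auto
  next
    fix x y assume "x \<in> ?C" "y \<in> ?C"
    then obtain h k where h: "h \<in> W" "x = g \<otimes> h \<otimes> inv g" and k: "k \<in> W" "y = g \<otimes> k \<otimes> inv g"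
      by auto
    have hk: "h \<in> carrier G" "k \<in> carrier G" using h k osub_carrier[OF W] by auto
    have "x \<otimes> y = g \<otimes> (h \<otimes> k) \<otimes> inv g"
      using hk g inv_solve_left[of g "k \<otimes> inv g" "k \<otimes> inv g"] unfolding h k
      by (simp add: m_assoc) (simp add: m_assoc[symmetric])
    then show "x \<otimes> y \<in> ?C" using osub_mult[OF W h(1) k(1)] by auto
  qed
  moreover have "openin T ?C"
    unfolding eq using W g by (intro open_translation_vimage) (auto simp: open_subgroup_def)
  ultimately show ?thesis by (simp add: open_subgroup_def)
qed

section \<open>Finitary actions\<close>

text \<open>
  Unlike in a hat set, the action need not be extensional on \<open>S\<close>, so that one and the same function
  serves for every invariant subset of \<open>S\<close> and every open subgroup of \<open>V\<close>.  The group of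
  definition is a parameter of the predicate only; volumes and integrals below do not mention it.
\<close>

definition finitary_action :: "'g set \<Rightarrow> 'y set \<Rightarrow> ('g \<Rightarrow> 'y \<Rightarrow> 'y) \<Rightarrow> bool" where
  "finitary_action V S a \<longleftrightarrow>
     osub V \<and> (\<forall>y\<in>S. a \<one> y = y) \<and> (\<forall>g\<in>V. \<forall>y\<in>S. a g y \<in> S) \<and>
     (\<forall>g\<in>V. \<forall>h\<in>V. \<forall>y\<in>S. a (g \<otimes> h) y = a g (a h y)) \<and>
     (\<forall>y\<in>S. osub (stab V a y)) \<and> finite (orb V a ` S)"

lemma finitary_actionD:
  assumes "finitary_action V S a"
  shows "osub V" "\<And>y. y \<in> S \<Longrightarrow> a \<one> y = y" "\<And>g y. \<lbrakk>g \<in> V; y \<in> S\<rbrakk> \<Longrightarrow> a g y \<in> S"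
    "\<And>g h y. \<lbrakk>g \<in> V; h \<in> V; y \<in> S\<rbrakk> \<Longrightarrow> a (g \<otimes> h) y = a g (a h y)"
    "\<And>y. y \<in> S \<Longrightarrow> osub (stab V a y)" "finite (orb V a ` S)"
  using assms by (auto simp: finitary_action_def)

lemma action_inverse:
  assumes "finitary_action V S a" "g \<in> V" "y \<in> S"
  shows "a (inv g) (a g y) = y" "a g (a (inv g) y) = y"
proof -
  note A = finitary_actionD[OF assms(1)]
  have g: "inv g \<in> V" "g \<in> carrier G" using A(1) assms osub_inv osub_carrier by auto
  show "a (inv g) (a g y) = y" "a g (a (inv g) y) = y"
    using A(2)[OF assms(3)] A(4)[OF g(1) assms(2,3)] A(4)[OF assms(2) g(1) assms(3)] g by auto
qed

lemma subgroup_stab: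
  assumes V: "osub V" and "y \<in> S" "a \<one> y = y"
    and cl: "\<And>g y. \<lbrakk>g \<in> V; y \<in> S\<rbrakk> \<Longrightarrow> a g y \<in> S"
    and m: "\<And>g h y. \<lbrakk>g \<in> V; h \<in> V; y \<in> S\<rbrakk> \<Longrightarrow> a (g \<otimes> h) y = a g (a h y)"
  shows "subgroup (stab V a y) G"
proof (rule subgroupI)
  show "stab V a y \<subseteq> carrier G" using osub_carrier[OF V] by (auto simp: stab_def)
  show "stab V a y \<noteq> {}" using osub_one[OF V] assms by (auto simp: stab_def)
next
  fix g assume g: "g \<in> stab V a y"
  then have gV: "g \<in> V" "inv g \<in> V" "a g y = y" using osub_inv[OF V] by (auto simp: stab_def)
  have "a (inv g) y = a (inv g) (a g y)" using gV by simp
  also have "\<dots> = a (inv g \<otimes> g) y" using gV assms m by simp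
  also have "\<dots> = y" using gV osub_carrier[OF V] assms by simp
  finally show "inv g \<in> stab V a y" using gV by (simp add: stab_def)
next
  fix g h assume "g \<in> stab V a y" "h \<in> stab V a y"
  then show "g \<otimes> h \<in> stab V a y" using osub_mult[OF V] m assms(2) by (auto simp: stab_def)
qed

lemma finitary_actionI:
  assumes V: "osub V" and one: "\<And>y. y \<in> S \<Longrightarrow> a \<one> y = y"
    and cl: "\<And>g y. \<lbrakk>g \<in> V; y \<in> S\<rbrakk> \<Longrightarrow> a g y \<in> S"
    and m: "\<And>g h y. \<lbrakk>g \<in> V; h \<in> V; y \<in> S\<rbrakk> \<Longrightarrow> a (g \<otimes> h) y = a g (a h y)"
    and st: "\<And>y. y \<in> S \<Longrightarrow> \<exists>W. osub W \<and> W \<subseteq> V \<and> (\<forall>g\<in>W. a g y = y)"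
    and fin: "finite (orb V a ` S)"
  shows "finitary_action V S a"
proof -
  have "osub (stab V a y)" if y: "y \<in> S" for y
  proof -
    obtain W where W: "osub W" "W \<subseteq> V" "\<forall>g\<in>W. a g y = y" using st[OF y] by blast
    have "subgroup (stab V a y) G" using subgroup_stab[where S=S] V y one cl m by blast
    moreover have "W \<subseteq> stab V a y" using W by (auto simp: stab_def)
    ultimately show ?thesis using open_subgroup_mono W(1) by blast
  qed
  then show ?thesis using assms by (auto simp: finitary_action_def)
qed

lemma orb_refl: "finitary_action V S a \<Longrightarrow> y \<in> S \<Longrightarrow> y \<in> orb V a y"
  using osub_one finitary_actionD(1,2) by (force simp: orb_def)

lemma orb_subset: "finitary_action V S a \<Longrightarrow> y \<in> S \<Longrightarrow> orb V a y \<subseteq> S"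
  using finitary_actionD(3) by (fastforce simp: orb_def)

lemma orb_move:
  assumes A: "finitary_action V S a" and g: "g \<in> V" and y: "y \<in> S"
  shows "orb V a (a g y) = orb V a y"
proof (intro Set.set_eqI iffI)
    note D = finitary_actionD[OF A]
    fix x assume "x \<in> orb V a (a g y)"
    then obtain h where "h \<in> V" "x = a h (a g y)" by (auto simp: orb_def)
    then show "x \<in> orb V a y" using D(4) g y osub_mult[OF D(1)] by (force simp: orb_def)
  next
    note D = finitary_actionD[OF A]
    fix x assume "x \<in> orb V a y"
    then obtain h where h: "h \<in> V" "x = a h y" by (auto simp: orb_def)
    have i: "inv g \<in> V" using osub_inv D g by auto
    have "a (h \<otimes> inv g) (a g y) = a h (a (inv g) (a g y))"
      using D(4)[OF h(1) i, of "a g y"] D(3) g y by auto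
    then have "x = a (h \<otimes> inv g) (a g y)" using h action_inverse[OF A g y] by simp
    then show "x \<in> orb V a (a g y)" using osub_mult[OF D(1) h(1) i] by (auto simp: orb_def)
qed

lemma orb_eq:
  assumes "finitary_action V S a" "y \<in> S" "x \<in> orb V a y"
  shows "orb V a x = orb V a y"
  using assms orb_move by (fastforce simp: orb_def[of V a y])

lemma orb_eq_iff:
  assumes "finitary_action V S a" "y \<in> S" "x \<in> S"
  shows "orb V a x = orb V a y \<longleftrightarrow> x \<in> orb V a y"
  using assms orb_eq orb_refl by metis

lemma finitary_action_subset:
  assumes A: "finitary_action V S a" and "S' \<subseteq> S" and "\<And>g y. \<lbrakk>g \<in> V; y \<in> S'\<rbrakk> \<Longrightarrow> a g y \<in> S'"
  shows "finitary_action V S' a"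
proof -
  have "finite (orb V a ` S')"
    using finitary_actionD(6)[OF A] assms(2) by (meson finite_subset image_mono)
  then show ?thesis using assms by (auto simp: finitary_action_def subset_eq)
qed

lemma finitary_action_orb:
  assumes A: "finitary_action V S a" and y: "y \<in> S"
  shows "finitary_action V (orb V a y) a"
proof (rule finitary_action_subset[OF A orb_subset[OF A y]])
  fix g x assume g: "g \<in> V" and x: "x \<in> orb V a y"
  have xS: "x \<in> S" using orb_subset[OF A y] x by blast
  have "a g x \<in> orb V a (a g x)" using orb_refl[OF A] finitary_actionD(3)[OF A g xS] by blast
  then show "a g x \<in> orb V a y" using orb_move[OF A g xS] orb_eq[OF A y x] by simp
qed

text \<open>
  Quotients, transports of structure and sets of tuples are all obtained as equivariant images.
\<close>

lemma finitary_action_image: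
  assumes A: "finitary_action V S a"
    and eq: "\<And>g y. \<lbrakk>g \<in> V; y \<in> S\<rbrakk> \<Longrightarrow> b g (f y) = f (a g y)"
  shows "finitary_action V (f ` S) b"
proof -
  note D = finitary_actionD[OF A]
  show ?thesis
  proof (rule finitary_actionI)
    show "osub V" by (rule D(1))
    show "\<And>y. y \<in> f ` S \<Longrightarrow> b \<one> y = y" using eq D(2) osub_one[OF D(1)] by auto
    show "\<And>g y. \<lbrakk>g \<in> V; y \<in> f ` S\<rbrakk> \<Longrightarrow> b g y \<in> f ` S" using eq D(3) by auto
    show "\<And>g h y. \<lbrakk>g \<in> V; h \<in> V; y \<in> f ` S\<rbrakk> \<Longrightarrow> b (g \<otimes> h) y = b g (b h y)"
      using eq D(3,4) osub_mult[OF D(1)] by auto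
  next
    fix y assume "y \<in> f ` S"
    then obtain x where x: "x \<in> S" "y = f x" by auto
    have "\<forall>g \<in> stab V a x. b g y = y" using eq x by (auto simp: stab_def)
    then show "\<exists>W. osub W \<and> W \<subseteq> V \<and> (\<forall>g\<in>W. b g y = y)"
      using D(5)[OF x(1)] by (intro exI[of _ "stab V a x"]) (auto simp: stab_def)
  next
    have "orb V b ` f ` S = image f ` (orb V a ` S)"
      using eq by (auto simp: orb_def image_image intro!: image_eqI)
    then show "finite (orb V b ` f ` S)" using D(6) by simp
  qed
qed

end

section \<open>Shrinking the group of definition\<close>

context pro_oligomorphic
begin

text \<open>
  A single \<open>V\<close>-orbit is \<open>V/H\<close> with \<open>H\<close> the stabilizer of a point, and its \<open>W\<close>-orbits correspond to
  double cosets of \<open>W\<close> and \<open>H\<close>; Roelcke precompactness says that there are finitely many of them.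
\<close>

lemma finite_orbits_shrink:
  assumes A: "finitary_action V S a" and W: "osub W" "W \<subseteq> V"
  shows "finite (orb W a ` S)"
proof -
  note D = finitary_actionD[OF A]
  have orb_fin: "finite (orb W a ` (orb V a y))" if y: "y \<in> S" for y
  proof -
    let ?H = "stab V a y"
    have H: "osub ?H" using D(5) y .
    have "orb W a (a g y) = (\<lambda>h. a h y) ` (W <#> (g <# ?H))" if g: "g \<in> V" for g
    proof (intro Set.set_eqI iffI)
      fix x assume "x \<in> orb W a (a g y)"
      then obtain w where w: "w \<in> W" "x = a w (a g y)" by (auto simp: orb_def)
      then have "x = a (w \<otimes> (g \<otimes> \<one>)) y"
        using W g y D(4) osub_carrier[OF D(1) g] by auto
      then show "x \<in> (\<lambda>h. a h y) ` (W <#> (g <# ?H))"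
        using w osub_one[OF H] by (auto simp: set_mult_def l_coset_def)
    next
      fix x assume "x \<in> (\<lambda>h. a h y) ` (W <#> (g <# ?H))"
      then obtain w h where w: "w \<in> W" "h \<in> ?H" "x = a (w \<otimes> (g \<otimes> h)) y"
        by (auto simp: set_mult_def l_coset_def)
      then have h: "h \<in> V" "a h y = y" by (auto simp: stab_def)
      have "x = a w (a (g \<otimes> h) y)" using w W D(4) osub_mult[OF D(1) g h(1)] y by auto
      also have "\<dots> = a w (a g y)" using D(4)[OF g h(1) y] h by simp
      finally show "x \<in> orb W a (a g y)" using w by (auto simp: orb_def)
    qed
    then have "orb W a ` (orb V a y) =
        (\<lambda>g. (\<lambda>h. a h y) ` (W <#> (g <# ?H))) ` V"
      by (auto simp: orb_def[of V a y] image_image)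
    also have "\<dots> \<subseteq> image (\<lambda>h. a h y) ` {W <#> (g <# ?H) | g. g \<in> carrier G}"
      using osub_carrier[OF D(1)] by blast
    finally have "orb W a ` (orb V a y) \<subseteq>
        image (\<lambda>h. a h y) ` {W <#> (g <# ?H) | g. g \<in> carrier G}" .
    then show ?thesis using Roelcke_precompact[OF W(1) H] by (meson finite_imageI finite_subset)
  qed
  obtain R where R: "finite R" "R \<subseteq> S" "orb V a ` S = orb V a ` R"
    using finite_subset_image[OF D(6) subset_refl] by metis
  have "orb W a ` S \<subseteq> (\<Union>y\<in>R. orb W a ` (orb V a y))"
  proof
    fix P assume "P \<in> orb W a ` S"
    then obtain x where x: "x \<in> S" "P = orb W a x" by auto
    then have "orb V a x \<in> orb V a ` R" using R(3) by blast
    then obtain y where y: "y \<in> R" "orb V a x = orb V a y" by auto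
    then have "x \<in> orb V a y" using orb_refl[OF A x(1)] by simp
    then show "P \<in> (\<Union>y\<in>R. orb W a ` (orb V a y))" using x y by auto
  qed
  moreover have "finite (\<Union>y\<in>R. orb W a ` (orb V a y))" using R orb_fin by auto
  ultimately show ?thesis by (meson finite_subset)
qed

lemma finitary_action_shrink:
  assumes A: "finitary_action V S a" and W: "osub W" "W \<subseteq> V"
  shows "finitary_action W S a"
proof -
  note D = finitary_actionD[OF A]
  show ?thesis
  proof (rule finitary_actionI)
    fix y assume y: "y \<in> S"
    show "\<exists>H. osub H \<and> H \<subseteq> W \<and> (\<forall>g\<in>H. a g y = y)"
      using osub_Int[OF W(1) D(5)[OF y]] by (intro exI[of _ "W \<inter> stab V a y"]) (auto simp: stab_def)
  next
    show "\<And>g h y. \<lbrakk>g \<in> W; h \<in> W; y \<in> S\<rbrakk> \<Longrightarrow> a (g \<otimes> h) y = a g (a h y)"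
      using D(4) W(2) by blast
  qed (use D W finite_orbits_shrink[OF assms] in auto)
qed

text \<open>
  Every orbit on the product meets \<open>{s} \<times> S'\<close> for one of finitely many representatives \<open>s\<close>, and there it is
  determined by an orbit of the stabilizer of \<open>s\<close> on \<open>S'\<close>.
\<close>

lemma finitary_action_prod:
  assumes A: "finitary_action V S a" and B: "finitary_action V S' b"
  shows "finitary_action V (S \<times> S') (\<lambda>g z. (a g (fst z), b g (snd z)))"
proof -
  let ?c = "\<lambda>g z. (a g (fst z), b g (snd z))"
  note D = finitary_actionD[OF A] and E = finitary_actionD[OF B]
  obtain R where R: "finite R" "R \<subseteq> S" "orb V a ` S = orb V a ` R"
    using finite_subset_image[OF D(6) subset_refl] by metis
  have mv: "orb V ?c (?c g z) = orb V ?c z" if g: "g \<in> V" and z: "z \<in> S \<times> S'" for g z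
  proof (intro Set.set_eqI iffI)
    fix x assume "x \<in> orb V ?c (?c g z)"
    then obtain h where "h \<in> V" "x = ?c h (?c g z)" by (auto simp: orb_def)
    then have "h \<otimes> g \<in> V" "x = ?c (h \<otimes> g) z" using D(4) E(4) z g osub_mult[OF D(1)] by auto
    then show "x \<in> orb V ?c z" by (auto simp: orb_def)
  next
    fix x assume "x \<in> orb V ?c z"
    then obtain h where h: "h \<in> V" "x = ?c h z" by (auto simp: orb_def)
    have i: "inv g \<in> V" using osub_inv[OF D(1) g] .
    have "a (h \<otimes> inv g) (a g (fst z)) = a h (a (inv g) (a g (fst z)))"
      using D(4)[OF h(1) i] D(3)[OF g] z by auto
    moreover have "b (h \<otimes> inv g) (b g (snd z)) = b h (b (inv g) (b g (snd z)))"
      using E(4)[OF h(1) i] E(3)[OF g] z by auto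
    ultimately have "x = ?c (h \<otimes> inv g) (?c g z)"
      using h action_inverse(1)[OF A g] action_inverse(1)[OF B g] z by auto
    then show "x \<in> orb V ?c (?c g z)" using osub_mult[OF D(1) h(1) i] unfolding orb_def by blast
  qed
  have fin: "finite ((\<lambda>t. orb V ?c (s, t)) ` S')" if s: "s \<in> S" for s
  proof (rule finite_image_factor)
    let ?W = "stab V a s"
    have W: "osub ?W" "?W \<subseteq> V" using D(5)[OF s] by (auto simp: stab_def)
    show "finite (orb ?W b ` S')" using finite_orbits_shrink[OF B W] .
    fix t t' assume t: "t \<in> S'" "t' \<in> S'" "orb ?W b t = orb ?W b t'"
    then have "t \<in> orb ?W b t'" using orb_refl[OF finitary_action_shrink[OF B W]] by metis
    then obtain w where w: "w \<in> ?W" "t = b w t'" by (auto simp: orb_def)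
    then have "(s, t) = ?c w (s, t')" "w \<in> V" by (auto simp: stab_def)
    then show "orb V ?c (s, t) = orb V ?c (s, t')" using mv[of w "(s,t')"] s t by simp
  qed
  have sub: "orb V ?c ` (S \<times> S') \<subseteq> (\<Union>s\<in>R. (\<lambda>t. orb V ?c (s, t)) ` S')"
  proof
    fix P assume "P \<in> orb V ?c ` (S \<times> S')"
    then obtain x t where x: "x \<in> S" "t \<in> S'" "P = orb V ?c (x, t)" by auto
    then have "orb V a x \<in> orb V a ` R" using R(3) by blast
    then obtain s where s: "s \<in> R" "orb V a x = orb V a s" by auto
    then have "s \<in> orb V a x" using orb_refl[OF A, of s] R(2) by auto
    then obtain g where g: "g \<in> V" "s = a g x" by (auto simp: orb_def)
    have "P = orb V ?c (s, b g t)" using mv[OF g(1), of "(x,t)"] x g by simp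
    then show "P \<in> (\<Union>s\<in>R. (\<lambda>t. orb V ?c (s, t)) ` S')" using s E(3)[OF g(1) x(2)] by auto
  qed
  show ?thesis
  proof (rule finitary_actionI)
    fix z assume z: "z \<in> S \<times> S'"
    show "\<exists>W. osub W \<and> W \<subseteq> V \<and> (\<forall>g\<in>W. ?c g z = z)"
      using osub_Int[OF D(5) E(5), of "fst z" "snd z"] z
      by (intro exI[of _ "stab V a (fst z) \<inter> stab V b (snd z)"]) (auto simp: stab_def)
  next
    show "finite (orb V ?c ` (S \<times> S'))"
      by (rule finite_subset[OF sub]) (use R fin in auto)
  qed (use D E in auto)
qed

end

section \<open>Finitary actions as hat sets\<close>

definition hat_of :: "'g set \<Rightarrow> 'y set \<Rightarrow> ('g \<Rightarrow> 'y \<Rightarrow> 'y) \<Rightarrow> ('g, 'y) hat_set" where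
  "hat_of V S a = \<lparr>points = S, defgrp = V, act = (\<lambda>g. restrict (a g) S)\<rparr>"

lemma hat_of_simps [simp]:
  "points (hat_of V S a) = S" "defgrp (hat_of V S a) = V"
  "act (hat_of V S a) = (\<lambda>g. restrict (a g) S)"
  by (simp_all add: hat_of_def)

lemma hat_sub_eq_hat_of: "hat_sub X V S = hat_of V S (act X)"
  by (simp add: hat_sub_def hat_of_def)

text \<open>
  The action on the image of \<open>j\<close> that makes \<open>j\<close> equivariant.
\<close>

definition transport :: "'y set \<Rightarrow> ('y \<Rightarrow> 'x) \<Rightarrow> ('g \<Rightarrow> 'y \<Rightarrow> 'y) \<Rightarrow> 'g \<Rightarrow> 'x \<Rightarrow> 'x" where
  "transport S j a = (\<lambda>g x. j (a g (inv_into S j x)))"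

lemma transport_apply: "inj_on j S \<Longrightarrow> y \<in> S \<Longrightarrow> transport S j a g (j y) = j (a g y)"
  by (simp add: transport_def)

context pro_oligomorphic
begin

lemma finitary_hat_of:
  assumes A: "finitary_action V S a"
  shows "finitary_hat_set G T (hat_of V S a)"
proof -
  note D = finitary_actionD[OF A]
  let ?V = "G\<lparr>carrier := V\<rparr>" and ?a = "\<lambda>g. restrict (a g) S"
  have Bij: "?a g \<in> Bij S" if g: "g \<in> V" for g
  proof -
    have i: "inv g \<in> V" using osub_inv[OF D(1) g] .
    have "bij_betw (?a g) S S"
      by (rule bij_betw_byWitness[where f' = "?a (inv g)"])
        (use D(3) g i action_inverse[OF A g] in auto)
    then show ?thesis by (simp add: Bij_def)
  qed
  have "?a \<in> hom ?V (BijGroup S)"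
  proof (rule homI)
    show "\<And>g. g \<in> carrier ?V \<Longrightarrow> ?a g \<in> carrier (BijGroup S)"
      using Bij by (simp add: BijGroup_def)
    fix g h assume "g \<in> carrier ?V" "h \<in> carrier ?V"
    then have g: "g \<in> V" and h: "h \<in> V" by auto
    have "?a (g \<otimes> h) = compose S (?a g) (?a h)"
      using D(3,4) g h by (intro ext) (auto simp: compose_def)
    then show "?a (g \<otimes>\<^bsub>?V\<^esub> h) = ?a g \<otimes>\<^bsub>BijGroup S\<^esub> ?a h"
      using Bij g h by (simp add: BijGroup_def)
  qed
  then have ga: "group_action ?V S ?a"
    using subgroup.subgroup_is_group[OF osub_subgroup[OF D(1)] is_group] group_BijGroup
    by (simp add: group_action_def group_hom_def group_hom_axioms_def)
  have st: "stabilizer ?V ?a x = stab V a x" if "x \<in> S" for x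
    using that by (auto simp: stabilizer_def stab_def)
  have "orbit ?V ?a x = orb V a x" if "x \<in> S" for x
    using that by (auto simp: orbit_def orb_def)
  then have "orbits ?V S ?a = orb V a ` S"
    by (auto simp: orbits_def)
  then show ?thesis
    using ga st D by (auto simp: finitary_hat_set_def is_hat_set_def open_subgroup_def)
qed

lemma finitary_action_hat:
  assumes X: "finitary_hat_set G T X"
  shows "finitary_action (defgrp X) (points X) (act X)"
proof -
  let ?V = "G\<lparr>carrier := defgrp X\<rparr>"
  have V: "osub (defgrp X)" and ga: "group_action ?V (points X) (act X)"
    and st: "\<And>x. x \<in> points X \<Longrightarrow> openin T (stabilizer ?V (act X) x)"
    and fin: "finite (orbits ?V (points X) (act X))"
    using X by (auto simp: finitary_hat_set_def is_hat_set_def)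
  interpret group_action ?V "points X" "act X" by (rule ga)
  have one: "act X \<one> y = y" if "y \<in> points X" for y
    using fun_cong[OF id_eq_one, of y] that by simp
  have cl: "\<And>g y. \<lbrakk>g \<in> defgrp X; y \<in> points X\<rbrakk> \<Longrightarrow> act X g y \<in> points X"
    using element_image by simp
  have m: "\<And>g h y. \<lbrakk>g \<in> defgrp X; h \<in> defgrp X; y \<in> points X\<rbrakk>
      \<Longrightarrow> act X (g \<otimes> h) y = act X g (act X h y)"
    using composition_rule by simp
  have "stabilizer ?V (act X) y = stab (defgrp X) (act X) y" for y
    by (auto simp: stabilizer_def stab_def)
  then have "osub (stab (defgrp X) (act X) y)" if "y \<in> points X" for y
    using st[OF that] subgroup_stab[where S="points X" and a="act X", OF V that one[OF that] cl m]
    by (simp add: open_subgroup_def)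
  moreover have "orbits ?V (points X) (act X) = orb (defgrp X) (act X) ` points X"
    by (auto simp: orbits_def orbit_def orb_def)
  ultimately show ?thesis using V one cl m fin by (simp add: finitary_action_def)
qed

lemma transitive_hat_of:
  assumes A: "finitary_action V S a" and z: "z \<in> S" "orb V a z = S"
  shows "transitive_hat_set G T (hat_of V S a)"
proof -
  have hs: "is_hat_set G T (hat_of V S a)"
    using finitary_hat_of[OF A] by (simp add: finitary_hat_set_def)
  have "\<exists>g\<in>V. a g x = y" if "x \<in> S" "y \<in> S" for x y
  proof -
    have "orb V a x = orb V a z" using orb_eq_iff[OF A] z that by metis
    then have "y \<in> orb V a x" using z that by simp
    then show ?thesis by (auto simp: orb_def)
  qed
  then show ?thesis
    using hs z
    by (auto simp: transitive_hat_set_def is_hat_set_def transitive_action_def transitive_action_axioms_def)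
qed

lemma finitary_transport:
  assumes "finitary_action V S a" "inj_on j S"
  shows "finitary_action V (j ` S) (transport S j a)"
  using assms by (intro finitary_action_image) (auto simp: transport_apply)

lemma finitary_action_conj:
  assumes A: "finitary_action V S a" and g: "g \<in> carrier G"
  shows "finitary_action ((\<lambda>h. g \<otimes> h \<otimes> inv g) ` V) S (\<lambda>h. a (inv g \<otimes> h \<otimes> g))"
proof -
  note D = finitary_actionD[OF A]
  let ?c = "\<lambda>h. g \<otimes> h \<otimes> inv g" and ?b = "\<lambda>h. a (inv g \<otimes> h \<otimes> g)"
  have b: "?b (?c h) = a h" if "h \<in> V" for h
    using that g osub_carrier[OF D(1)] by (simp add: conj_inverse)
  have mult: "?c h \<otimes> ?c k = ?c (h \<otimes> k)" if "h \<in> V" "k \<in> V" for h k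
    using that g osub_carrier[OF D(1)] by (simp add: m_assoc) (simp add: m_assoc[symmetric])
  show ?thesis
  proof (rule finitary_actionI)
    show "osub (?c ` V)" by (rule osub_conj[OF D(1) g])
    show "\<And>y. y \<in> S \<Longrightarrow> ?b \<one> y = y" using D(2) g by simp
    show "\<And>h y. \<lbrakk>h \<in> ?c ` V; y \<in> S\<rbrakk> \<Longrightarrow> ?b h y \<in> S" using b D(3) by auto
    fix h k y assume "h \<in> ?c ` V" "k \<in> ?c ` V" and y: "y \<in> S"
    then obtain h' k' where h: "h' \<in> V" "k' \<in> V" and e: "h = ?c h'" "k = ?c k'" by auto
    show "?b (h \<otimes> k) y = ?b h (?b k y)"
      unfolding e mult[OF h] b[OF h(1)] b[OF h(2)] b[OF osub_mult[OF D(1) h]]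
      by (rule D(4)[OF h y])
  next
    fix y assume y: "y \<in> S"
    show "\<exists>W. osub W \<and> W \<subseteq> ?c ` V \<and> (\<forall>h\<in>W. ?b h y = y)"
      using osub_conj[OF D(5)[OF y] g] b
      by (intro exI[of _ "?c ` stab V a y"]) (auto simp: stab_def)
  next
    have "orb (?c ` V) ?b y = orb V a y" for y
      using b by (auto simp: orb_def image_image)
    then show "finite (orb (?c ` V) ?b ` S)" using D(6) by simp
  qed
qed

end

section \<open>Volumes of finitary actions on sets of any type\<close>

locale universal_measure = pro_oligomorphic G T + hat_measure G T \<mu>
  for G :: "('g, 'm) monoid_scheme" (structure) and T
    and \<mu> :: "('g, 'x) hat_set \<Rightarrow> 'k::comm_ring_1" +
  assumes large: "large_universe G TYPE('x)"
begin

text \<open>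
  A point \<open>y\<close> is determined by its orbit, which is encoded by a natural number, and by the set of group
  elements that carry a chosen representative of the orbit to \<open>y\<close>.
\<close>

lemma ex_injection:
  assumes A: "finitary_action V S a"
  shows "\<exists>j :: 'y \<Rightarrow> 'x. inj_on j S"
proof -
  note D = finitary_actionD[OF A]
  obtain \<iota> :: "nat \<times> 'g set \<Rightarrow> 'x" where \<iota>: "inj_on \<iota> (UNIV \<times> Pow (carrier G))"
    using large by (auto simp: large_universe_def)
  obtain n :: "'y set \<Rightarrow> nat" where n: "inj_on n (orb V a ` S)"
    using finite_imp_inj_to_nat_seg[OF D(6)] by blast
  define r where "r P = (SOME y. y \<in> P)" for P :: "'y set"
  have r: "r (orb V a y) \<in> orb V a y" if "y \<in> S" for y
    unfolding r_def using orb_refl[OF A that] by (rule someI)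
  have rS: "r (orb V a y) \<in> S" "orb V a (r (orb V a y)) = orb V a y" if "y \<in> S" for y
    using r[OF that] orb_subset[OF A that] orb_eq[OF A that] by auto
  define C where "C y = {g \<in> V. a g (r (orb V a y)) = y}" for y
  define j where "j y = \<iota> (n (orb V a y), C y)" for y
  have "inj_on j S"
  proof (rule inj_onI)
    fix x y assume x: "x \<in> S" and y: "y \<in> S" and "j x = j y"
    moreover have "C x \<subseteq> carrier G" "C y \<subseteq> carrier G"
      using osub_carrier[OF D(1)] by (auto simp: C_def)
    ultimately have "n (orb V a x) = n (orb V a y)" and C: "C x = C y"
      using \<iota> by (auto simp: j_def dest!: inj_onD)
    then have o: "orb V a x = orb V a y" using n x y by (auto dest: inj_onD)
    have "x \<in> orb V a (r (orb V a x))" using rS(2)[OF x] orb_refl[OF A x] by simp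
    then obtain g where g: "g \<in> V" "x = a g (r (orb V a x))" by (auto simp: orb_def)
    then have "g \<in> C x" by (simp add: C_def)
    then have "g \<in> C y" using C by simp
    then show "x = y" using g o by (simp add: C_def)
  qed
  then show ?thesis by blast
qed

text \<open>
  Both the injection and the group of definition are chosen arbitrarily; \<open>vol_eq\<close> shows that neither
  choice matters.
\<close>

definition vol :: "'y set \<Rightarrow> ('g \<Rightarrow> 'y \<Rightarrow> 'y) \<Rightarrow> 'k" where
  "vol S a = (let j = SOME j :: 'y \<Rightarrow> 'x. inj_on j S
     in \<mu> (hat_of (SOME V. finitary_action V S a) (j ` S) (transport S j a)))"

text \<open>
  Composed with the inverse of the chosen injection, \<open>f\<close> becomes an isomorphism of hat sets, and \<open>\<mu>\<close> is
  invariant under isomorphism.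
\<close>

lemma vol_eq:
  fixes Z :: "'x set"
  assumes A: "finitary_action V S a" and B: "finitary_action W Z b"
    and H: "osub H" "H \<subseteq> V" "H \<subseteq> W" and f: "bij_betw f S Z"
    and eq: "\<And>g y. \<lbrakk>g \<in> H; y \<in> S\<rbrakk> \<Longrightarrow> f (a g y) = b g (f y)"
  shows "vol S a = \<mu> (hat_of W Z b)"
proof -
  define j where "j = (SOME j :: 'a \<Rightarrow> 'x. inj_on j S)"
  have j: "inj_on j S" unfolding j_def using ex_injection[OF A] by (rule someI_ex)
  define U where "U = (SOME V. finitary_action V S a)"
  have U: "finitary_action U S a" unfolding U_def using A by (rule someI)
  let ?Y = "hat_of U (j ` S) (transport S j a)"
  let ?f = "\<lambda>x. f (inv_into S j x)"
  have fY: "finitary_hat_set G T ?Y"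
    by (intro finitary_hat_of finitary_transport U j)
  have bij: "bij_betw ?f (j ` S) Z"
    using bij_betw_trans[OF bij_betw_inv_into[OF inj_on_imp_bij_betw[OF j]] f]
    by (simp add: o_def)
  have inZ: "f y \<in> Z" if "y \<in> S" for y using f that by (auto simp: bij_betw_def)
  have "hat_map G T ?Y (hat_of W Z b) ?f"
    unfolding hat_map_def
  proof (intro exI conjI)
    show "osub (H \<inter> U)" using osub_Int H(1) finitary_actionD(1)[OF U] by blast
    show "H \<inter> U \<subseteq> defgrp ?Y \<inter> defgrp (hat_of W Z b)" using H by auto
    show "equivariant (H \<inter> U) ?Y (hat_of W Z b) ?f"
      using inZ eq j finitary_actionD(3)[OF U]
      by (auto simp: equivariant_def transport_apply)
  qed
  then have "hat_iso G T ?Y (hat_of W Z b)" using bij by (auto simp: hat_iso_def)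
  then have "\<mu> ?Y = \<mu> (hat_of W Z b)"
    using iso_invariant[OF fY finitary_hat_of[OF B]] by simp
  then show ?thesis by (simp add: vol_def Let_def j_def U_def)
qed

lemma vol_transport:
  fixes j :: "'y \<Rightarrow> 'x"
  assumes A: "finitary_action V S a" and j: "inj_on j S"
  shows "vol S a = \<mu> (hat_of V (j ` S) (transport S j a))"
  using finitary_actionD(1)[OF A] j
  by (intro vol_eq[OF A finitary_transport[OF A j], where H = V and f = j])
    (auto simp: transport_apply inj_on_imp_bij_betw)

lemma vol_iso:
  assumes A: "finitary_action V S a" and B: "finitary_action W Z b"
    and H: "osub H" "H \<subseteq> V" "H \<subseteq> W" and f: "bij_betw f S Z"
    and eq: "\<And>g y. \<lbrakk>g \<in> H; y \<in> S\<rbrakk> \<Longrightarrow> f (a g y) = b g (f y)"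
  shows "vol S a = vol Z b"
proof -
  obtain j :: "_ \<Rightarrow> 'x" where j: "inj_on j Z" using ex_injection[OF B] by blast
  have bij: "bij_betw (j \<circ> f) S (j ` Z)"
    using bij_betw_trans[OF f inj_on_imp_bij_betw[OF j]] .
  have "f y \<in> Z" if "y \<in> S" for y using f that by (auto simp: bij_betw_def)
  then have "vol S a = \<mu> (hat_of W (j ` Z) (transport Z j b))"
    using eq j
    by (intro vol_eq[OF A finitary_transport[OF B j] H bij]) (auto simp: transport_apply)
  also have "\<dots> = vol Z b" using vol_transport[OF B j] by simp
  finally show ?thesis .
qed

lemma vol_Un:
  assumes A: "finitary_action V S a" and B: "finitary_action V S' a" and dj: "S \<inter> S' = {}"
    and AB: "finitary_action V (S \<union> S') a"
  shows "vol (S \<union> S') a = vol S a + vol S' a"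
proof -
  obtain j :: "_ \<Rightarrow> 'x" where j: "inj_on j (S \<union> S')" using ex_injection[OF AB] by blast
  let ?b = "transport (S \<union> S') j a"
  have ap: "?b g (j y) = j (a g y)" if "y \<in> S \<union> S'" for g y
    using transport_apply[OF j that] .
  have jS: "inj_on j S" "inj_on j S'" using j by (auto simp: inj_on_Un)
  have fb: "finitary_action V (j ` S) ?b" "finitary_action V (j ` S') ?b"
    by (rule finitary_action_image[OF A], simp add: ap)
      (rule finitary_action_image[OF B], simp add: ap)
  have V: "osub V" using finitary_actionD(1)[OF A] .
  have "vol S a = \<mu> (hat_of V (j ` S) ?b)"
    by (rule vol_eq[OF A fb(1) V subset_refl subset_refl inj_on_imp_bij_betw[OF jS(1)]])
      (simp add: ap)
  moreover have "vol S' a = \<mu> (hat_of V (j ` S') ?b)"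
    by (rule vol_eq[OF B fb(2) V subset_refl subset_refl inj_on_imp_bij_betw[OF jS(2)]])
      (simp add: ap)
  \<comment> \<open>One injection of the whole union serves both parts, so their coproduct is the union on the nose.\<close>
  moreover have "hat_coprod (hat_of V (j ` S) ?b) (hat_of V (j ` S') ?b) = hat_of V (j ` (S \<union> S')) ?b"
    by (auto simp: hat_coprod_def hat_of_def image_Un intro!: ext)
  moreover have "j ` S \<inter> j ` S' = {}"
    using j dj by (auto simp: inj_on_def)
  ultimately show ?thesis
    using vol_transport[OF AB j] additive[OF finitary_hat_of[OF fb(1)] finitary_hat_of[OF fb(2)]]
    by simp
qed

lemma vol_empty: "osub V \<Longrightarrow> vol {} a = 0"
proof -
  assume "osub V"
  then have "finitary_action V {} a" by (simp add: finitary_action_def)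
  from vol_Un[OF this this] this show ?thesis by simp
qed

lemma vol_singleton:
  assumes A: "finitary_action V {y} a"
  shows "vol {y} a = 1"
proof -
  obtain j :: "_ \<Rightarrow> 'x" where j: "inj_on j {y}" by auto
  have "is_hat_set G T (hat_of V (j ` {y}) (transport {y} j a))"
    using finitary_hat_of[OF finitary_transport[OF A j]] by (simp add: finitary_hat_set_def)
  then show ?thesis using one_point vol_transport[OF A j] by simp
qed

text \<open>
  The translate by \<open>g\<close> is isomorphic to \<open>S\<close> with the action conjugated by \<open>g\<close>, so this is the axiom of
  invariance under conjugation.
\<close>

lemma vol_translate:
  assumes Z: "finitary_action V Z a" and g: "g \<in> V"
    and S: "finitary_action W S a" "S \<subseteq> Z" "W \<subseteq> V"
  shows "vol (a g ` S) a = vol S a"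
proof -
  note D = finitary_actionD[OF Z]
  let ?c = "\<lambda>h. g \<otimes> h \<otimes> inv g"
  have gc: "g \<in> carrier G" and i: "inv g \<in> V" using osub_carrier[OF D(1) g] osub_inv[OF D(1) g] .
  obtain j :: "_ \<Rightarrow> 'x" where j: "inj_on j S" using ex_injection[OF S(1)] by blast
  let ?b = "transport S j a"
  let ?B = "\<lambda>h. ?b (inv g \<otimes> h \<otimes> g)"
  have c: "?c h \<in> V" "inv g \<otimes> ?c h \<otimes> g = h" "h \<in> carrier G" "h \<in> V" if "h \<in> W" for h
  proof -
    show "h \<in> V" using that S by auto
    then show "h \<in> carrier G" "?c h \<in> V" using osub_carrier[OF D(1)] osub_mult[OF D(1)] i g by auto
    then show "inv g \<otimes> ?c h \<otimes> g = h" using gc by (simp add: conj_inverse)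
  qed
  have mv: "a (?c h) (a g y) = a g (a h y)" if "h \<in> W" "y \<in> S" for h y
  proof -
    have y: "y \<in> Z" using that S by auto
    have "a (?c h) (a g y) = a (?c h \<otimes> g) y" using D(4)[OF c(1)[OF that(1)] g y] by simp
    also have "?c h \<otimes> g = g \<otimes> h" using gc c[OF that(1)] by (simp add: m_assoc)
    also have "a (g \<otimes> h) y = a g (a h y)" using D(4)[OF g c(4)[OF that(1)] y] .
    finally show ?thesis .
  qed
  have F: "finitary_action (?c ` W) (a g ` S) a"
    using mv c by (intro finitary_action_image[OF finitary_action_conj[OF S(1) gc]]) auto
  have fb: "finitary_action W (j ` S) ?b" by (rule finitary_transport[OF S(1) j])
  have fB: "finitary_action (?c ` W) (j ` S) ?B"
    by (rule finitary_action_conj[OF fb gc])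
  have inv: "a (inv g) (a g y) = y" if "y \<in> S" for y
    using action_inverse[OF Z g] that S by auto
  have bij: "bij_betw (\<lambda>z. j (a (inv g) z)) (a g ` S) (j ` S)"
    using inv j by (auto simp: bij_betw_def inj_on_def image_image)
  have "vol (a g ` S) a = \<mu> (hat_of (?c ` W) (j ` S) ?B)"
  proof (rule vol_eq[OF F fB _ _ _ bij])
    show "osub (?c ` W)" using finitary_actionD(1)[OF F] .
    fix h z assume "h \<in> ?c ` W" "z \<in> a g ` S"
    then obtain h' y where h: "h' \<in> W" "h = ?c h'" and y: "y \<in> S" "z = a g y" by auto
    show "j (a (inv g) (a h z)) = ?B h (j (a (inv g) z))"
      unfolding h(2) y(2) mv[OF h(1) y(1)] inv[OF y(1)] c(2)[OF h(1)]
        inv[OF finitary_actionD(3)[OF S(1) h(1) y(1)]] transport_apply[OF j y(1)] ..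
  qed auto
  also have "hat_of (?c ` W) (j ` S) ?B = hat_conj G g (hat_of W (j ` S) ?b)"
    by (simp add: hat_of_def hat_conj_def)
  also have "\<mu> \<dots> = \<mu> (hat_of W (j ` S) ?b)"
    using conj_invariant[OF finitary_hat_of[OF fb] gc] .
  also have "\<dots> = vol S a" using vol_transport[OF S(1) j] by simp
  finally show "vol (a g ` S) a = vol S a" .
qed

text \<open>
  The fibration axiom, moved along injections of both sets into the type that carries \<open>\<mu>\<close>.
\<close>

lemma vol_fibration:
  assumes A: "finitary_action V S a" "z \<in> S" "orb V a z = S"
    and B: "finitary_action V Y b" "y \<in> Y" "orb V b y = Y"
    and f: "\<And>x. x \<in> S \<Longrightarrow> f x \<in> Y"
    and eq: "\<And>g x. \<lbrakk>g \<in> V; x \<in> S\<rbrakk> \<Longrightarrow> f (a g x) = b g (f x)"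
  shows "vol S a = vol {x \<in> S. f x = y} a * vol Y b"
proof -
  note D = finitary_actionD[OF A(1)]
  obtain j :: "_ \<Rightarrow> 'x" where j: "inj_on j S" using ex_injection[OF A(1)] by blast
  obtain k :: "_ \<Rightarrow> 'x" where k: "inj_on k Y" using ex_injection[OF B(1)] by blast
  let ?W = "stab V b y" and ?F = "{x \<in> S. f x = y}"
  let ?a = "transport S j a" and ?b = "transport Y k b"
  let ?f = "\<lambda>x. k (f (inv_into S j x))"
  have W: "osub ?W" "?W \<subseteq> V" using finitary_actionD(5)[OF B(1,2)] by (auto simp: stab_def)
  have FA: "finitary_action ?W ?F a"
    by (rule finitary_action_subset[OF finitary_action_shrink[OF A(1) W]])
      (use eq D(3) W in \<open>auto simp: stab_def\<close>)
  have tr: "finitary_action V (j ` S) ?a" "finitary_action V (k ` Y) ?b"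
    using finitary_transport A(1) B(1) j k by auto
  have orb: "orb V (transport S' l c) (l w) = l ` orb V c w" if "inj_on l S'" "w \<in> S'"
    for S' :: "'w set" and l :: "'w \<Rightarrow> 'x" and c w
    using that by (simp add: orb_def transport_apply image_image)
  have T1: "transitive_hat_set G T (hat_of V (j ` S) ?a)"
    using orb[OF j A(2)] A by (intro transitive_hat_of[OF tr(1), where z="j z"]) auto
  have T2: "transitive_hat_set G T (hat_of V (k ` Y) ?b)"
    using orb[OF k B(2)] B by (intro transitive_hat_of[OF tr(2), where z="k y"]) auto
  have "equivariant V (hat_of V (j ` S) ?a) (hat_of V (k ` Y) ?b) ?f"
    using f eq j k D(3) by (auto simp: equivariant_def transport_apply)
  from fibration[OF T1 T2 _ _ this, of "k y"]
  have "\<mu> (hat_of V (j ` S) ?a) =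
      \<mu> (hat_sub (hat_of V (j ` S) ?a) (stabilizer (G\<lparr>carrier := V\<rparr>) (act (hat_of V (k ` Y) ?b)) (k y))
           {x \<in> j ` S. ?f x = k y}) * \<mu> (hat_of V (k ` Y) ?b)"
    using B(2) by simp
  moreover have "stabilizer (G\<lparr>carrier := V\<rparr>) (act (hat_of V (k ` Y) ?b)) (k y) = ?W"
    using B(2) k finitary_actionD(3)[OF B(1)]
    by (auto simp: stabilizer_def stab_def transport_apply inj_on_def)
  moreover have "{x \<in> j ` S. ?f x = k y} = j ` ?F"
    using j k f B(2) by (auto simp: inj_on_def)
  moreover have "hat_sub (hat_of V (j ` S) ?a) ?W (j ` ?F) = hat_of ?W (j ` ?F) ?a"
    by (auto simp: hat_sub_def hat_of_def intro!: ext)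
  moreover have "vol ?F a = \<mu> (hat_of ?W (j ` ?F) ?a)"
  proof (rule vol_eq[OF FA _ W(1)])
    show "finitary_action ?W (j ` ?F) ?a"
      using FA j by (intro finitary_action_image) (auto simp: transport_apply)
    show "bij_betw j ?F (j ` ?F)" using j by (auto intro!: inj_on_imp_bij_betw inj_on_subset[OF j])
  qed (use j in \<open>auto simp: transport_apply\<close>)
  ultimately show ?thesis
    using vol_transport[OF A(1) j] vol_transport[OF B(1) k] by simp
qed

end

section \<open>Cycles of prime power order\<close>

text \<open>
  The cardinality of the cycle is the least period of \<open>s\<close>, which divides \<open>p ^ m\<close> and is not \<open>1\<close>.
\<close>

lemma prime_dvd_card_cycle:
  fixes r :: "'a \<Rightarrow> 'a"
  assumes p: "prime p" and q: "(r ^^ (p ^ m)) s = s" and s: "r s \<noteq> s"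
  shows "finite (range (\<lambda>i. (r ^^ i) s))" "p dvd card (range (\<lambda>i. (r ^^ i) s))"
proof -
  let ?P = "\<lambda>n. n > 0 \<and> (r ^^ n) s = s"
  define n where "n = (LEAST n. ?P n)"
  have "?P (p ^ m)" using q p prime_gt_0_nat by auto
  then have "?P n" unfolding n_def by (rule LeastI)
  then have n0: "n > 0" and n: "(r ^^ n) s = s" by auto
  have least: "k \<ge> n" if "k > 0" "(r ^^ k) s = s" for k
    unfolding n_def using that by (intro Least_le) simp
  have mod: "(r ^^ (k mod n)) s = (r ^^ k) s" for k
    using funpow_mod_eq[OF n] .
  have range: "range (\<lambda>i. (r ^^ i) s) = (\<lambda>i. (r ^^ i) s) ` {..<n}"
  proof
    show "range (\<lambda>i. (r ^^ i) s) \<subseteq> (\<lambda>i. (r ^^ i) s) ` {..<n}"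
    proof
      fix x assume "x \<in> range (\<lambda>i. (r ^^ i) s)"
      then obtain i where "x = (r ^^ (i mod n)) s" using mod by auto
      then show "x \<in> (\<lambda>i. (r ^^ i) s) ` {..<n}" using n0 by auto
    qed
  qed auto
  have neq: "(r ^^ i) s \<noteq> (r ^^ j) s" if "i < j" "j < n" for i j
  proof
    assume "(r ^^ i) s = (r ^^ j) s"
    then have "(r ^^ (n - j + i)) s = (r ^^ (n - j + j)) s" unfolding funpow_add by simp
    then have "(r ^^ (n - j + i)) s = s" using that n by simp
    then have "n - j + i \<ge> n" using that by (intro least) auto
    then show False using that by simp
  qed
  have "inj_on (\<lambda>i. (r ^^ i) s) {..<n}"
    by (rule linorder_inj_onI') (use neq in auto)
  then have card: "card (range (\<lambda>i. (r ^^ i) s)) = n"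
    using range by (simp add: card_image)
  have "p ^ m mod n = 0"
    using least[of "p ^ m mod n"] mod[of "p ^ m"] q n0 by (metis mod_less_divisor not_le neq0_conv)
  then have "n dvd p ^ m" by auto
  then obtain i where i: "n = p ^ i" using p by (auto simp: divides_primepow_nat)
  have "n \<noteq> 1" using n s by auto
  then have "i > 0" using i by (cases i) auto
  then show "p dvd card (range (\<lambda>i. (r ^^ i) s))" using i card by simp
  show "finite (range (\<lambda>i. (r ^^ i) s))" using range by simp
qed

section \<open>Integration\<close>

context universal_measure
begin

lemma finitary_action_Un_orbits:
  assumes A: "finitary_action V S a" and P: "\<P> \<subseteq> orb V a ` S"
  shows "finitary_action V (\<Union>\<P>) a"
proof (rule finitary_action_subset[OF A])
  show "\<Union>\<P> \<subseteq> S" using P orb_subset[OF A] by blast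
  fix g x assume g: "g \<in> V" and "x \<in> \<Union>\<P>"
  then obtain y where y: "y \<in> S" "orb V a y \<in> \<P>" "x \<in> orb V a y" using P by auto
  then show "a g x \<in> \<Union>\<P>"
    using finitary_actionD(3)[OF finitary_action_orb[OF A y(1)] g y(3)] by blast
qed

lemma vol_orbits:
  assumes A: "finitary_action V S a"
  shows "vol S a = (\<Sum>P\<in>orb V a ` S. vol P a)"
proof -
  have "vol (\<Union>\<P>) a = (\<Sum>P\<in>\<P>. vol P a)" if "finite \<P>" "\<P> \<subseteq> orb V a ` S" for \<P>
    using that
  proof (induction \<P>)
    case empty
    then show ?case using vol_empty finitary_actionD(1)[OF A] by simp
  next
    case (insert P \<P>)
    then obtain y where y: "y \<in> S" "P = orb V a y" by auto
    have "P \<inter> \<Union>\<P> = {}"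
    proof (rule ccontr)
      assume "P \<inter> \<Union>\<P> \<noteq> {}"
      then obtain x Q where "x \<in> P" "x \<in> Q" "Q \<in> \<P>" by auto
      moreover then obtain z where "z \<in> S" "Q = orb V a z" using insert.prems by auto
      ultimately have "P = Q" using orb_eq[OF A] y by metis
      then show False using \<open>Q \<in> \<P>\<close> insert.hyps by simp
    qed
    moreover have "finitary_action V (\<Union>(insert P \<P>)) a" "finitary_action V (\<Union>\<P>) a"
      by (rule finitary_action_Un_orbits[OF A], use insert.prems in blast)+
    ultimately have "vol (P \<union> \<Union>\<P>) a = vol P a + vol (\<Union>\<P>) a"
      using finitary_action_orb[OF A y(1)] y(2) by (intro vol_Un) auto
    then show ?case using insert by simp
  qed
  from this[OF finitary_actionD(6)[OF A] subset_refl]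
  have "vol (\<Union>(orb V a ` S)) a = (\<Sum>P\<in>orb V a ` S. vol P a)" .
  moreover have "\<Union>(orb V a ` S) = S" using orb_refl[OF A] orb_subset[OF A] by blast
  ultimately show ?thesis by simp
qed

text \<open>
  The integral over level sets, as for Schwartz functions, but including the value \<open>0\<close> (whose term
  vanishes) and without reference to a group of definition.
\<close>

definition action_integral :: "'y set \<Rightarrow> ('g \<Rightarrow> 'y \<Rightarrow> 'y) \<Rightarrow> ('y \<Rightarrow> 'k) \<Rightarrow> 'k" where
  "action_integral S a \<phi> = (\<Sum>c\<in>\<phi> ` S. c * vol {x \<in> S. \<phi> x = c} a)"

lemma action_integral_cong: "(\<And>x. x \<in> S \<Longrightarrow> \<phi> x = \<psi> x) \<Longrightarrow> action_integral S a \<phi> = action_integral S a \<psi>"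
  unfolding action_integral_def by (intro sum.cong) (auto cong: image_cong conj_cong intro!: arg_cong2[where f=vol])

lemma action_integral_zero: "(\<And>x. x \<in> S \<Longrightarrow> \<phi> x = 0) \<Longrightarrow> action_integral S a \<phi> = 0"
  unfolding action_integral_def by (intro sum.neutral) auto

lemma rep_orb:
  assumes "finitary_action V S a" "y \<in> S"
  shows "(SOME x. x \<in> orb V a y) \<in> orb V a y"
  by (rule someI) (rule orb_refl[OF assms])

lemma invariant_rep:
  assumes A: "finitary_action V S a" "y \<in> S"
    and inv: "\<And>g y. \<lbrakk>g \<in> V; y \<in> S\<rbrakk> \<Longrightarrow> \<phi> (a g y) = \<phi> y"
  shows "\<phi> (SOME x. x \<in> orb V a y) = \<phi> y"
  using rep_orb[OF A] inv A(2) by (auto simp: orb_def)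

lemma finitary_level_set:
  assumes A: "finitary_action V S a"
    and inv: "\<And>g y. \<lbrakk>g \<in> V; y \<in> S\<rbrakk> \<Longrightarrow> \<phi> (a g y) = \<phi> y"
  shows "finitary_action V {x \<in> S. \<phi> x = c} a"
  by (rule finitary_action_subset[OF A]) (use inv finitary_actionD(3)[OF A] in auto)

text \<open>
  The working form of the integral: an invariant function is constant on orbits, and each level
  set is a finite disjoint union of orbits.  This makes linearity and additivity immediate, and it holds
  for every group \<open>V\<close> that leaves the function invariant.
\<close>

lemma action_integral_orbits:
  assumes A: "finitary_action V S a"
    and inv: "\<And>g y. \<lbrakk>g \<in> V; y \<in> S\<rbrakk> \<Longrightarrow> \<phi> (a g y) = \<phi> y"
  shows "action_integral S a \<phi> = (\<Sum>P\<in>orb V a ` S. \<phi> (SOME y. y \<in> P) * vol P a)"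
proof -
  let ?r = "\<lambda>P. \<phi> (SOME y. y \<in> P)"
  have r: "?r (orb V a y) = \<phi> y" if "y \<in> S" for y
    by (rule invariant_rep[OF A that]) (rule inv)
  have "?r ` (orb V a ` S) = \<phi> ` S" using r by (force simp: image_image)
  moreover have "(\<Sum>P\<in>{P \<in> orb V a ` S. ?r P = c}. ?r P * vol P a) = c * vol {x \<in> S. \<phi> x = c} a" for c
  proof -
    have "{P \<in> orb V a ` S. ?r P = c} = orb V a ` {x \<in> S. \<phi> x = c}" using r by auto
    moreover have "vol {x \<in> S. \<phi> x = c} a = (\<Sum>P\<in>orb V a ` {x \<in> S. \<phi> x = c}. vol P a)"
      by (rule vol_orbits[OF finitary_level_set[OF A]]) (rule inv)
    ultimately show ?thesis using r by (auto simp: sum_distrib_left intro!: sum.cong)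
  qed
  ultimately show ?thesis
    unfolding action_integral_def using sum.image_gen[OF finitary_actionD(6)[OF A], of "\<lambda>P. ?r P * vol P a" ?r]
    by simp
qed

lemma action_integral_Un:
  assumes A: "finitary_action V (S \<union> S') a" and dj: "S \<inter> S' = {}"
    and S: "\<And>g y. \<lbrakk>g \<in> V; y \<in> S\<rbrakk> \<Longrightarrow> a g y \<in> S" "\<And>g y. \<lbrakk>g \<in> V; y \<in> S'\<rbrakk> \<Longrightarrow> a g y \<in> S'"
    and inv: "\<And>g y. \<lbrakk>g \<in> V; y \<in> S \<union> S'\<rbrakk> \<Longrightarrow> \<phi> (a g y) = \<phi> y"
  shows "action_integral (S \<union> S') a \<phi> = action_integral S a \<phi> + action_integral S' a \<phi>"
proof -
  have F: "finitary_action V S a" "finitary_action V S' a"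
    using S by (auto intro: finitary_action_subset[OF A])
  have "orb V a ` S \<inter> orb V a ` S' = {}"
  proof (rule ccontr)
    assume "orb V a ` S \<inter> orb V a ` S' \<noteq> {}"
    then obtain x y where "x \<in> S" "y \<in> S'" "orb V a x = orb V a y" by auto
    then have "x \<in> S'" using orb_refl[OF F(1)] orb_subset[OF F(2)] by blast
    then show False using dj \<open>x \<in> S\<close> by blast
  qed
  moreover have "action_integral (S \<union> S') a \<phi> = (\<Sum>P\<in>orb V a ` (S \<union> S'). \<phi> (SOME y. y \<in> P) * vol P a)"
    using inv by (rule action_integral_orbits[OF A])
  moreover have "action_integral S a \<phi> = (\<Sum>P\<in>orb V a ` S. \<phi> (SOME y. y \<in> P) * vol P a)"
    using inv by (intro action_integral_orbits[OF F(1)]) auto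
  moreover have "action_integral S' a \<phi> = (\<Sum>P\<in>orb V a ` S'. \<phi> (SOME y. y \<in> P) * vol P a)"
    using inv by (intro action_integral_orbits[OF F(2)]) auto
  ultimately show ?thesis
    using finitary_actionD(6)[OF F(1)] finitary_actionD(6)[OF F(2)]
    by (simp add: image_Un sum.union_disjoint)
qed

lemma action_integral_mult_left:
  assumes A: "finitary_action V S a"
    and inv: "\<And>g y. \<lbrakk>g \<in> V; y \<in> S\<rbrakk> \<Longrightarrow> \<phi> (a g y) = \<phi> y"
  shows "action_integral S a (\<lambda>x. c * \<phi> x) = c * action_integral S a \<phi>"
proof -
  have "action_integral S a (\<lambda>x. c * \<phi> x) = (\<Sum>P\<in>orb V a ` S. c * \<phi> (SOME y. y \<in> P) * vol P a)"
    by (rule action_integral_orbits[OF A]) (simp add: inv)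
  also have "\<dots> = c * (\<Sum>P\<in>orb V a ` S. \<phi> (SOME y. y \<in> P) * vol P a)"
    by (simp add: sum_distrib_left mult.assoc)
  also have "\<dots> = c * action_integral S a \<phi>" using action_integral_orbits[OF A, of \<phi>] inv by simp
  finally show ?thesis .
qed

lemma action_integral_image:
  assumes A: "finitary_action V S a" and f: "inj_on f S"
    and eq: "\<And>g y. \<lbrakk>g \<in> V; y \<in> S\<rbrakk> \<Longrightarrow> b g (f y) = f (a g y)"
    and inv: "\<And>g y. \<lbrakk>g \<in> V; y \<in> S\<rbrakk> \<Longrightarrow> \<phi> (f (a g y)) = \<phi> (f y)"
  shows "action_integral (f ` S) b \<phi> = action_integral S a (\<lambda>x. \<phi> (f x))"
proof -
  have "vol {z \<in> f ` S. \<phi> z = c} b = vol {x \<in> S. \<phi> (f x) = c} a" for c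
  proof -
    let ?L = "{x \<in> S. \<phi> (f x) = c}"
    have L: "finitary_action V ?L a" using inv by (intro finitary_level_set[OF A])
    have "{z \<in> f ` S. \<phi> z = c} = f ` ?L" by auto
    moreover have "vol ?L a = vol (f ` ?L) b"
    proof (rule vol_iso[OF L])
      show "finitary_action V (f ` ?L) b" using eq by (intro finitary_action_image[OF L]) auto
      show "osub V" by (rule finitary_actionD(1)[OF A])
      show "bij_betw f ?L (f ` ?L)" by (intro inj_on_imp_bij_betw inj_on_subset[OF f]) auto
    qed (use eq in auto)
    ultimately show ?thesis by simp
  qed
  then show ?thesis by (simp add: action_integral_def image_image)
qed

text \<open>
  On a finite set with trivial action the orbits are points, of volume \<open>1\<close>.
\<close>

lemma action_integral_trivial_action:
  assumes A: "finitary_action V S a" and fin: "finite S"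
    and triv: "\<And>g y. \<lbrakk>g \<in> V; y \<in> S\<rbrakk> \<Longrightarrow> a g y = y"
  shows "action_integral S a \<phi> = (\<Sum>y\<in>S. \<phi> y)"
proof -
  have orb: "orb V a y = {y}" if "y \<in> S" for y
    using orb_refl[OF A that] triv that by (auto simp: orb_def)
  have "action_integral S a \<phi> = (\<Sum>P\<in>orb V a ` S. \<phi> (SOME y. y \<in> P) * vol P a)"
    using triv by (intro action_integral_orbits[OF A]) auto
  also have "orb V a ` S = (\<lambda>y. {y}) ` S" using orb by auto
  also have "(\<Sum>P\<in>(\<lambda>y. {y}) ` S. \<phi> (SOME y. y \<in> P) * vol P a) = (\<Sum>y\<in>S. \<phi> y * vol {y} a)"
    by (subst sum.reindex) auto
  also have "\<dots> = (\<Sum>y\<in>S. \<phi> y)"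
    using finitary_action_orb[OF A] orb vol_singleton by (intro sum.cong) force+
  finally show ?thesis .
qed

lemma action_integral_translate:
  assumes Z: "finitary_action V Z a" and g: "g \<in> V"
    and S: "finitary_action W S a" "S \<subseteq> Z" "W \<subseteq> V"
    and inv: "\<And>g y. \<lbrakk>g \<in> V; y \<in> Z\<rbrakk> \<Longrightarrow> \<phi> (a g y) = \<phi> y"
  shows "action_integral (a g ` S) a \<phi> = action_integral S a \<phi>"
proof -
  have i: "\<phi> (a g y) = \<phi> y" if "y \<in> S" for y using inv g S that by auto
  have "vol {z \<in> a g ` S. \<phi> z = c} a = vol {x \<in> S. \<phi> x = c} a" for c
  proof -
    have "{z \<in> a g ` S. \<phi> z = c} = a g ` {x \<in> S. \<phi> x = c}" using i by auto
    moreover have "vol (a g ` {x \<in> S. \<phi> x = c}) a = vol {x \<in> S. \<phi> x = c} a"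
      using S inv by (intro vol_translate[OF Z g finitary_level_set[OF S(1)]]) auto
    ultimately show ?thesis by simp
  qed
  moreover have "\<phi> ` a g ` S = \<phi> ` S" using i by (force simp: image_image)
  ultimately show ?thesis by (simp add: action_integral_def)
qed

section \<open>Fubini's theorem\<close>

lemma finitary_fiber:
  assumes Z: "finitary_action V Z b" and Y: "finitary_action V Y a" "y \<in> Y"
    and eq: "\<And>g z. \<lbrakk>g \<in> V; z \<in> Z\<rbrakk> \<Longrightarrow> f (b g z) = a g (f z)"
  shows "finitary_action (stab V a y) {z \<in> Z. f z = y} b"
proof -
  have W: "osub (stab V a y)" "stab V a y \<subseteq> V"
    using finitary_actionD(5)[OF Y] by (auto simp: stab_def)
  show ?thesis
    by (rule finitary_action_subset[OF finitary_action_shrink[OF Z W]])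
      (use eq finitary_actionD(3)[OF Z] in \<open>auto simp: stab_def\<close>)
qed

text \<open>
  The fiber over \<open>a g y\<close> is the translate by \<open>g\<close> of the fiber over \<open>y\<close>; this is what makes the inner
  integral of Fubini's theorem an invariant function.
\<close>

lemma fiber_integral_invariant:
  assumes Z: "finitary_action V Z b" and Y: "finitary_action V Y a"
    and eq: "\<And>g z. \<lbrakk>g \<in> V; z \<in> Z\<rbrakk> \<Longrightarrow> f (b g z) = a g (f z)"
    and inv: "\<And>g z. \<lbrakk>g \<in> V; z \<in> Z\<rbrakk> \<Longrightarrow> \<phi> (b g z) = \<phi> z"
    and g: "g \<in> V" and y: "y \<in> Y"
  shows "action_integral {z \<in> Z. f z = a g y} b \<phi> = action_integral {z \<in> Z. f z = y} b \<phi>"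
proof -
  note D = finitary_actionD[OF Z]
  have "{z \<in> Z. f z = a g y} = b g ` {z \<in> Z. f z = y}"
  proof (intro Set.set_eqI iffI)
    fix z assume z: "z \<in> {z \<in> Z. f z = a g y}"
    have i: "inv g \<in> V" using osub_inv[OF D(1) g] .
    have "f (b (inv g) z) = y" using eq[OF i] z action_inverse(1)[OF Y g y] by auto
    moreover have "z = b g (b (inv g) z)" using action_inverse(2)[OF Z g] z by auto
    ultimately show "z \<in> b g ` {z \<in> Z. f z = y}" using D(3)[OF i] z by blast
  qed (use eq g D(3) in auto)
  then show ?thesis
    using action_integral_translate[OF Z g finitary_fiber[OF Z Y y, of f], where \<phi>=\<phi>] eq inv
    by (auto simp: stab_def)
qed

text \<open>
  Let \<open>Q\<close> be an orbit of \<open>Y\<close> and \<open>y \<in> Q\<close>.  The \<open>V\<close>-orbits \<open>P\<close> lying over \<open>Q\<close> correspond to the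
  orbits of the stabilizer of \<open>y\<close> on the fiber over \<open>y\<close>, by intersecting \<open>P\<close> with the fiber, and
  \<open>vol_fibration\<close> says that \<open>vol P\<close> is the volume of this intersection times \<open>vol Q\<close>.  Summing over
  \<open>P\<close> and then over \<open>Q\<close> gives the theorem.
\<close>

theorem action_integral_fubini:
  assumes Z: "finitary_action V Z b" and Y: "finitary_action V Y a"
    and f: "\<And>z. z \<in> Z \<Longrightarrow> f z \<in> Y"
    and eq: "\<And>g z. \<lbrakk>g \<in> V; z \<in> Z\<rbrakk> \<Longrightarrow> f (b g z) = a g (f z)"
    and inv: "\<And>g z. \<lbrakk>g \<in> V; z \<in> Z\<rbrakk> \<Longrightarrow> \<phi> (b g z) = \<phi> z"
  shows "action_integral Z b \<phi> = action_integral Y a (\<lambda>y. action_integral {z \<in> Z. f z = y} b \<phi>)"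
proof -
  let ?rep = "\<lambda>P. SOME z. z \<in> P" and ?repY = "\<lambda>Q. SOME y. y \<in> Q"
  let ?F = "\<lambda>y. {z \<in> Z. f z = y}"
  let ?t = "\<lambda>P. \<phi> (?rep P) * vol P b"
  have im: "f ` orb V b z = orb V a (f z)" if "z \<in> Z" for z
    using eq that by (auto simp: orb_def image_image)
  have main: "(\<Sum>P\<in>{P \<in> orb V b ` Z. f ` P = Q}. ?t P) = action_integral (?F (?repY Q)) b \<phi> * vol Q a"
    if Q: "Q \<in> orb V a ` Y" for Q
  proof -
    obtain y0 where y0: "y0 \<in> Y" "Q = orb V a y0" using Q by auto
    define y where "y = ?repY Q"
    have yQ: "y \<in> Q" unfolding y_def y0(2) by (rule rep_orb[OF Y y0(1)])
    have y: "y \<in> Y" "orb V a y = Q"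
      using yQ y0 orb_subset[OF Y y0(1)] orb_eq[OF Y y0(1)] by auto
    let ?W = "stab V a y"
    have W: "finitary_action ?W (?F y) b" using eq by (intro finitary_fiber[OF Z Y y(1)])
    have WV: "?W \<subseteq> V" by (auto simp: stab_def)
    have cut: "orb V b z \<inter> ?F y = orb ?W b z" if z: "z \<in> ?F y" for z
      using z eq WV orb_subset[OF Z, of z] orb_subset[OF W z]
      by (auto simp: orb_def stab_def)
    have meets: "\<exists>z\<in>?F y. P = orb V b z" if P: "P \<in> orb V b ` Z" "f ` P = Q" for P
    proof -
      obtain z0 where z0: "z0 \<in> Z" "P = orb V b z0" using P by auto
      obtain z where z: "z \<in> P" "f z = y" using P yQ by auto
      then have "z \<in> Z" "orb V b z = P" using z0 orb_subset[OF Z z0(1)] orb_eq[OF Z z0(1)] by auto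
      then show ?thesis using z by auto
    qed
    have bij: "bij_betw (\<lambda>P. P \<inter> ?F y) {P \<in> orb V b ` Z. f ` P = Q} (orb ?W b ` ?F y)"
      unfolding bij_betw_def
    proof
      show "inj_on (\<lambda>P. P \<inter> ?F y) {P \<in> orb V b ` Z. f ` P = Q}"
      proof (rule inj_onI)
        fix P P' assume P: "P \<in> {P \<in> orb V b ` Z. f ` P = Q}" "P' \<in> {P \<in> orb V b ` Z. f ` P = Q}"
          and e: "P \<inter> ?F y = P' \<inter> ?F y"
        obtain z where z: "z \<in> ?F y" "P = orb V b z" using meets P(1) by blast
        obtain z' where z': "z' \<in> ?F y" "P' = orb V b z'" using meets P(2) by blast
        have "z \<in> P'" using e z orb_refl[OF Z] by auto
        then show "P = P'" using z z' orb_eq[OF Z, of z' z] by auto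
      qed
      show "(\<lambda>P. P \<inter> ?F y) ` {P \<in> orb V b ` Z. f ` P = Q} = orb ?W b ` ?F y"
      proof (intro Set.set_eqI iffI)
        fix R assume "R \<in> (\<lambda>P. P \<inter> ?F y) ` {P \<in> orb V b ` Z. f ` P = Q}"
        then obtain P where P: "P \<in> orb V b ` Z" "f ` P = Q" "R = P \<inter> ?F y" by auto
        then obtain z where "z \<in> ?F y" "P = orb V b z" using meets by blast
        then show "R \<in> orb ?W b ` ?F y" using P cut by auto
      next
        fix R assume "R \<in> orb ?W b ` ?F y"
        then obtain z where z: "z \<in> ?F y" "R = orb V b z \<inter> ?F y" using cut by auto
        then show "R \<in> (\<lambda>P. P \<inter> ?F y) ` {P \<in> orb V b ` Z. f ` P = Q}"
          using im[of z] y by (intro image_eqI[of _ _ "orb V b z"]) auto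
      qed
    qed
    have summand: "?t P = ?t (P \<inter> ?F y) * vol Q a" if P: "P \<in> {P \<in> orb V b ` Z. f ` P = Q}" for P
    proof -
      obtain z where z: "z \<in> ?F y" "P = orb V b z" using meets P by blast
      have zZ: "z \<in> Z" "f z = y" using z by auto
      have "\<phi> (?rep P) = \<phi> z" unfolding z(2) by (rule invariant_rep[OF Z zZ(1)]) (rule inv)
      moreover have "\<phi> (?rep (P \<inter> ?F y)) = \<phi> z"
        unfolding z(2) cut[OF z(1)] by (rule invariant_rep[OF W z(1)]) (use inv WV in auto)
      moreover have "vol P b = vol {x \<in> P. f x = y} b * vol Q a"
      proof (rule vol_fibration[where V=V and z=z])
        show "finitary_action V P b" using finitary_action_orb[OF Z zZ(1)] z by simp
        show "z \<in> P" using z orb_refl[OF Z zZ(1)] by simp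
        show "finitary_action V Q a" using finitary_action_orb[OF Y y(1)] y by simp
        show "\<And>x. x \<in> P \<Longrightarrow> f x \<in> Q" using P by auto
        show "\<And>g x. \<lbrakk>g \<in> V; x \<in> P\<rbrakk> \<Longrightarrow> f (b g x) = a g (f x)"
          using eq orb_subset[OF Z zZ(1)] z by auto
      qed (use z y yQ in auto)
      moreover have "{x \<in> P. f x = y} = P \<inter> ?F y" using orb_subset[OF Z zZ(1)] z by auto
      ultimately show ?thesis by (simp add: mult.assoc)
    qed
    have "(\<Sum>P\<in>{P \<in> orb V b ` Z. f ` P = Q}. ?t P)
        = (\<Sum>P\<in>{P \<in> orb V b ` Z. f ` P = Q}. ?t (P \<inter> ?F y)) * vol Q a"
      unfolding sum_distrib_right by (rule sum.cong[OF refl summand])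
    also have "(\<Sum>P\<in>{P \<in> orb V b ` Z. f ` P = Q}. ?t (P \<inter> ?F y)) = (\<Sum>R\<in>orb ?W b ` ?F y. ?t R)"
      by (rule sum.reindex_bij_betw[OF bij])
    also have "\<dots> = action_integral (?F y) b \<phi>"
      using inv WV by (intro action_integral_orbits[OF W, symmetric]) auto
    finally show ?thesis by (simp add: y_def)
  qed
  have "action_integral Z b \<phi> = (\<Sum>P\<in>orb V b ` Z. ?t P)"
    by (rule action_integral_orbits[OF Z]) (rule inv)
  also have "\<dots> = (\<Sum>Q\<in>orb V a ` Y. \<Sum>P\<in>{P \<in> orb V b ` Z. f ` P = Q}. ?t P)"
    using im f by (intro sum.group[symmetric] finitary_actionD(6)[OF Z] finitary_actionD(6)[OF Y]) auto
  also have "\<dots> = (\<Sum>Q\<in>orb V a ` Y. action_integral (?F (?repY Q)) b \<phi> * vol Q a)"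
    by (rule sum.cong[OF refl main])
  also have "\<dots> = action_integral Y a (\<lambda>y. action_integral (?F y) b \<phi>)"
  proof (rule action_integral_orbits[OF Y, symmetric])
    fix g y assume "g \<in> V" "y \<in> Y"
    then show "action_integral (?F (a g y)) b \<phi> = action_integral (?F y) b \<phi>"
      using eq inv by (intro fiber_integral_invariant[OF Z Y])
  qed
  finally show ?thesis .
qed

section \<open>Fixed points in characteristic p\<close>

text \<open>
  The cyclic group of order \<open>p ^ m\<close> acts on \<open>S\<close> through \<open>r\<close>, commuting with the action of \<open>V\<close>.  The points not
  fixed by \<open>r\<close> fiber over the set of cycles of \<open>r\<close>, with finite fibers of cardinality divisible by \<open>p\<close>.
  The stabilizer of a point fixes its whole cycle, because \<open>r\<close> is equivariant, so
  the integral over a fiber is the cardinality of the fiber times the value of \<open>\<phi>\<close>, that is, zero.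
\<close>

lemma action_integral_fixed_points:
  assumes p: "prime p" "of_nat p = (0::'k)"
    and A: "finitary_action V S a"
    and inv: "\<And>g y. \<lbrakk>g \<in> V; y \<in> S\<rbrakk> \<Longrightarrow> \<phi> (a g y) = \<phi> y"
    and r: "\<And>s. s \<in> S \<Longrightarrow> r s \<in> S" "\<And>s. s \<in> S \<Longrightarrow> (r ^^ (p ^ m)) s = s"
    and eq: "\<And>g s. \<lbrakk>g \<in> V; s \<in> S\<rbrakk> \<Longrightarrow> r (a g s) = a g (r s)"
    and rinv: "\<And>s. s \<in> S \<Longrightarrow> \<phi> (r s) = \<phi> s"
  shows "action_integral S a \<phi> = action_integral {s \<in> S. r s = s} a \<phi>"
proof -
  note D = finitary_actionD[OF A]
  let ?D = "{s \<in> S. r s = s}" and ?N = "{s \<in> S. r s \<noteq> s}"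
  have m: "p ^ m > 0" using p(1) prime_gt_0_nat by simp
  have rS: "(r ^^ i) s \<in> S" if "s \<in> S" for i s using r(1) that by (induction i) auto
  have reqv: "(r ^^ i) (a g s) = a g ((r ^^ i) s)" if "g \<in> V" "s \<in> S" for i g s
    using eq rS that by (induction i) auto
  have r_inj: "s = t" if "r s = r t" "s \<in> S" "t \<in> S" for s t
  proof -
    obtain n where "p ^ m = Suc n" using m gr0_implies_Suc by blast
    then have "(r ^^ (p ^ m)) s = (r ^^ (p ^ m)) t"
      using that by (simp only: funpow_Suc_right o_apply)
    then show ?thesis using r(2) that by simp
  qed
  have fix_iff: "r (a g y) = a g y \<longleftrightarrow> r y = y" if "g \<in> V" "y \<in> S" for g y
    using eq[OF that] action_inverse(1)[OF A that] action_inverse(1)[OF A that(1) r(1)[OF that(2)]]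
    by metis
  have DN: "\<And>g y. \<lbrakk>g \<in> V; y \<in> ?D\<rbrakk> \<Longrightarrow> a g y \<in> ?D" "\<And>g y. \<lbrakk>g \<in> V; y \<in> ?N\<rbrakk> \<Longrightarrow> a g y \<in> ?N"
    using fix_iff D(3) by auto
  have N: "finitary_action V ?N a" using DN by (intro finitary_action_subset[OF A]) auto
  have "action_integral ?N a \<phi> = 0"
  proof -
    define C where "C s = range (\<lambda>i. (r ^^ i) s)" for s
    have refl: "s \<in> C s" for s by (auto simp: C_def intro: range_eqI[of _ _ 0])
    have CN: "C s \<subseteq> ?N" if "s \<in> ?N" for s
    proof -
      have "(r ^^ i) s \<in> ?N" for i
        using that r(1) r_inj by (induction i) auto
      then show ?thesis by (auto simp: C_def)
    qed
    have C_eq: "C t = C s" if s: "s \<in> ?N" and t: "t \<in> C s" for s t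
    proof -
      obtain i where i: "t = (r ^^ i) s" using t by (auto simp: C_def)
      have per: "(r ^^ (p ^ m * k)) s = s" for k
        using r(2) s by (induction k) (auto simp: funpow_add)
      have sub: "C ((r ^^ k) u) \<subseteq> C u" for k u
      proof
        fix x assume "x \<in> C ((r ^^ k) u)"
        then obtain l where "x = (r ^^ (l + k)) u" by (auto simp: C_def funpow_add)
        then show "x \<in> C u" by (auto simp: C_def)
      qed
      have "i \<le> p ^ m * i" using m by (cases "p ^ m") auto
      then have "p ^ m * i - i + i = p ^ m * i" by (rule le_add_diff_inverse2)
      moreover have "(r ^^ (p ^ m * i - i)) t = (r ^^ (p ^ m * i - i + i)) s"
        unfolding funpow_add i by simp
      ultimately have "s = (r ^^ (p ^ m * i - i)) t" using per[of i] by simp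
      then have "C s \<subseteq> C t" using sub[of "p ^ m * i - i" t] by simp
      moreover have "C t \<subseteq> C s" unfolding i by (rule sub)
      ultimately show ?thesis by blast
    qed
    let ?b = "\<lambda>g. image (a g)"
    have Ceqv: "?b g (C s) = C (a g s)" if "g \<in> V" "s \<in> ?N" for g s
      using reqv that by (auto simp: C_def image_image)
    have Y: "finitary_action V (C ` ?N) ?b"
      using Ceqv by (rule finitary_action_image[OF N])
    have "action_integral ?N a \<phi> = action_integral (C ` ?N) ?b (\<lambda>c. action_integral {s \<in> ?N. C s = c} a \<phi>)"
      using Ceqv inv by (intro action_integral_fubini[OF N Y]) auto
    also have "\<dots> = 0"
    proof (rule action_integral_zero)
      fix c assume "c \<in> C ` ?N"
      then obtain s where s: "s \<in> ?N" "c = C s" by auto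
      have fib: "{t \<in> ?N. C t = c} = C s" using s refl CN[OF s(1)] C_eq[OF s(1)] by blast
      have prime: "finite (C s)" "p dvd card (C s)"
        unfolding C_def using prime_dvd_card_cycle[OF p(1), of m r s] s(1) r(2) by simp_all
      let ?W = "stab V a s"
      have W: "osub ?W" "?W \<subseteq> V" using D(5) s by (auto simp: stab_def)
      have triv: "a g t = t" if g: "g \<in> ?W" and t: "t \<in> C s" for g t
      proof -
        obtain i where i: "t = (r ^^ i) s" using t by (auto simp: C_def)
        show ?thesis using reqv[of g s i] g s by (simp add: stab_def i)
      qed
      have "finitary_action ?W (C s) a"
        by (rule finitary_action_subset[OF finitary_action_shrink[OF N W] CN[OF s(1)]])
          (simp add: triv)
      then have "action_integral (C s) a \<phi> = (\<Sum>t\<in>C s. \<phi> t)"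
        using prime(1) triv by (rule action_integral_trivial_action)
      also have "\<dots> = (\<Sum>t\<in>C s. \<phi> s)"
      proof (intro sum.cong HOL.refl)
        fix t assume "t \<in> C s"
        then obtain i where "t = (r ^^ i) s" by (auto simp: C_def)
        moreover have "\<phi> ((r ^^ i) s) = \<phi> s" using s rS rinv by (induction i) auto
        ultimately show "\<phi> t = \<phi> s" by simp
      qed
      also have "\<dots> = 0" using prime(2) p(2) by (auto simp: dvd_def)
      finally show "action_integral {t \<in> ?N. C t = c} a \<phi> = 0" using fib by simp
    qed
    finally show ?thesis .
  qed
  moreover have "action_integral (?D \<union> ?N) a \<phi> = action_integral ?D a \<phi> + action_integral ?N a \<phi>"
  proof (rule action_integral_Un)
    show "finitary_action V (?D \<union> ?N) a"
      using A by (simp add: Collect_disj_eq[symmetric] conj_disj_distribL[symmetric])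
  qed (use DN inv in auto)
  moreover have "?D \<union> ?N = S" by auto
  ultimately show ?thesis by simp
qed

end

section \<open>Integrals over tuples\<close>

definition tuples :: "nat \<Rightarrow> 'y set \<Rightarrow> 'y list set" where
  "tuples n S = {xs. length xs = n \<and> set xs \<subseteq> S}"

lemma tuples_0: "tuples 0 S = {[]}"
  by (auto simp: tuples_def)

lemma tuples_Suc: "tuples (Suc n) S = (\<lambda>z. fst z # snd z) ` (S \<times> tuples n S)"
proof (intro Set.set_eqI iffI)
  fix xs assume "xs \<in> tuples (Suc n) S"
  then show "xs \<in> (\<lambda>z. fst z # snd z) ` (S \<times> tuples n S)"
    by (cases xs) (force simp: tuples_def)+
qed (auto simp: tuples_def)

text \<open>
  The recursion peels off the last factor: the list contains the intermediate points in reverse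
  order, so that its head is the variable of the outermost integral in a power of a matrix, where
  a further factor is multiplied on the right.
\<close>

primrec path_weight :: "('y \<times> 'y \<Rightarrow> 'k::comm_ring_1) \<Rightarrow> 'y \<Rightarrow> 'y list \<Rightarrow> 'y \<Rightarrow> 'k" where
  "path_weight A x [] z = A (x, z)"
| "path_weight A x (y # ys) z = path_weight A x ys y * A (y, z)"

lemma path_weight_snoc: "path_weight A x (ys @ [w]) z = A (x, w) * path_weight A w ys z"
  by (induction ys arbitrary: z) (simp_all add: mult.assoc)

lemma path_weight_replicate: "path_weight A x (replicate n x) x = A (x, x) ^ Suc n"
  by (induction n) simp_all

lemma path_weight_cong:
  assumes "\<And>x z. \<lbrakk>x \<in> S; z \<in> S\<rbrakk> \<Longrightarrow> A (f x, f z) = A (x, z)"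
    and "x \<in> S" "z \<in> S" "set ys \<subseteq> S"
  shows "path_weight A (f x) (map f ys) (f z) = path_weight A x ys z"
  using assms(2-) by (induction ys arbitrary: z) (simp_all add: assms(1))

definition cycle_weight :: "('y \<times> 'y \<Rightarrow> 'k::comm_ring_1) \<Rightarrow> 'y list \<Rightarrow> 'k" where
  "cycle_weight A zs = path_weight A (hd zs) (tl zs) (hd zs)"

lemma cycle_weight_rotate1: "cycle_weight A (rotate1 zs) = cycle_weight A zs"
proof (cases zs)
  case (Cons x ys)
  then show ?thesis
    by (cases ys) (simp_all add: cycle_weight_def path_weight_snoc mult.commute)
qed simp

context universal_measure
begin

lemma finitary_tuples:
  assumes A: "finitary_action V S a"
  shows "finitary_action V (tuples n S) (\<lambda>g. map (a g))"
proof (induction n)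
  case 0
  have "finitary_action V {[]} (\<lambda>g. map (a g))"
    using finitary_actionD(1)[OF A]
    by (intro finitary_actionI) auto
  then show ?case by (simp add: tuples_0)
next
  case (Suc n)
  then show ?case unfolding tuples_Suc
    by (intro finitary_action_image[OF finitary_action_prod[OF A Suc]]) auto
qed

text \<open>
  Fubini's theorem for the head of a tuple, whose fibers are sets of shorter tuples.  The second
  part, invariance of the inner integral, is needed to compare the outer integral with an integral
  in the matrix algebra.
\<close>

lemma action_integral_tuples_Suc:
  assumes A: "finitary_action V S a"
    and inv: "\<And>g xs. \<lbrakk>g \<in> V; xs \<in> tuples (Suc n) S\<rbrakk> \<Longrightarrow> \<phi> (map (a g) xs) = \<phi> xs"
  shows "action_integral (tuples (Suc n) S) (\<lambda>g. map (a g)) \<phi> =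
      action_integral S a (\<lambda>x. action_integral (tuples n S) (\<lambda>g. map (a g)) (\<lambda>xs. \<phi> (x # xs)))" (is ?eq)
    and "\<And>g x. \<lbrakk>g \<in> V; x \<in> S\<rbrakk> \<Longrightarrow>
      action_integral (tuples n S) (\<lambda>g. map (a g)) (\<lambda>xs. \<phi> (a g x # xs)) =
      action_integral (tuples n S) (\<lambda>g. map (a g)) (\<lambda>xs. \<phi> (x # xs))"
proof -
  let ?b = "\<lambda>g. map (a g)"
  let ?Z = "tuples (Suc n) S"
  note D = finitary_actionD[OF A]
  have Z: "finitary_action V ?Z ?b" by (rule finitary_tuples[OF A])
  have hd: "hd xs \<in> S" if "xs \<in> ?Z" for xs using that by (cases xs) (auto simp: tuples_def)
  have eq: "hd (map (a g) xs) = a g (hd xs)" if "xs \<in> ?Z" for g xs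
    using that by (cases xs) (auto simp: tuples_def)
  have fib: "action_integral {xs \<in> ?Z. hd xs = x} ?b \<phi> = action_integral (tuples n S) ?b (\<lambda>xs. \<phi> (x # xs))"
    if x: "x \<in> S" for x
  proof -
    have W: "osub (stab V a x)" "stab V a x \<subseteq> V" using D(5) x by (auto simp: stab_def)
    have img: "{xs \<in> ?Z. hd xs = x} = (\<lambda>xs. x # xs) ` tuples n S"
    proof (intro Set.set_eqI iffI)
      fix zs assume "zs \<in> {xs \<in> ?Z. hd xs = x}"
      then show "zs \<in> (\<lambda>xs. x # xs) ` tuples n S" by (cases zs) (auto simp: tuples_def)
    qed (use x in \<open>auto simp: tuples_def\<close>)
    have "map (a g) (x # xs) = x # map (a g) xs" if "g \<in> stab V a x" for g xs
      using that by (simp add: stab_def)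
    moreover have "\<phi> (map (a g) (x # xs)) = \<phi> (x # xs)"
      if "g \<in> stab V a x" "xs \<in> tuples n S" for g xs
      using that W(2) x by (intro inv) (auto simp: tuples_def)
    ultimately show ?thesis unfolding img
      by (intro action_integral_image[where V = "stab V a x" and a = ?b and b = ?b and \<phi> = \<phi>]
          finitary_action_shrink[OF finitary_tuples[OF A] W]) (simp_all add: inj_on_def)
  qed
  show ?eq
    using action_integral_fubini[OF Z A, of hd \<phi>] hd eq inv fib by (simp cong: action_integral_cong)
  fix g x assume "g \<in> V" "x \<in> S"
  then show "action_integral (tuples n S) ?b (\<lambda>xs. \<phi> (a g x # xs)) = action_integral (tuples n S) ?b (\<lambda>xs. \<phi> (x # xs))"
    using fiber_integral_invariant[OF Z A, of hd \<phi> g x] eq inv fib D(3) by simp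
qed

lemma action_integral_prod_list:
  assumes A: "finitary_action V S a"
    and inv: "\<And>g x. \<lbrakk>g \<in> V; x \<in> S\<rbrakk> \<Longrightarrow> h (a g x) = h x"
  shows "action_integral (tuples n S) (\<lambda>g. map (a g)) (\<lambda>xs. prod_list (map h xs)) = action_integral S a h ^ n"
proof (induction n)
  case 0
  have "finitary_action V {[]} (\<lambda>g. map (a g))" using finitary_tuples[OF A, of 0] by (simp add: tuples_0)
  from action_integral_trivial_action[OF this] show ?case by (simp add: tuples_0)
next
  case (Suc n)
  have i: "prod_list (map h (map (a g) xs)) = prod_list (map h xs)"
    if "g \<in> V" "xs \<in> tuples k S" for g xs k
  proof -
    have "map h (map (a g) xs) = map h xs" using that inv by (auto simp: tuples_def)
    then show ?thesis by (simp only:)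
  qed
  have "action_integral (tuples (Suc n) S) (\<lambda>g. map (a g)) (\<lambda>xs. prod_list (map h xs)) =
      action_integral S a (\<lambda>x. action_integral (tuples n S) (\<lambda>g. map (a g)) (\<lambda>xs. prod_list (map h (x # xs))))"
    by (rule action_integral_tuples_Suc(1)[OF A, where \<phi> = "\<lambda>xs. prod_list (map h xs)"]) (rule i)
  also have "\<dots> = action_integral S a (\<lambda>x. action_integral S a h ^ n * h x)"
  proof (rule action_integral_cong)
    fix x
    have "action_integral (tuples n S) (\<lambda>g. map (a g)) (\<lambda>xs. h x * prod_list (map h xs)) =
        h x * action_integral (tuples n S) (\<lambda>g. map (a g)) (\<lambda>xs. prod_list (map h xs))"
      by (rule action_integral_mult_left[OF finitary_tuples[OF A], where \<phi> = "\<lambda>xs. prod_list (map h xs)"])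
        (rule i)
    then show "action_integral (tuples n S) (\<lambda>g. map (a g)) (\<lambda>xs. prod_list (map h (x # xs))) = action_integral S a h ^ n * h x"
      using Suc by (simp add: mult.commute)
  qed
  also have "\<dots> = action_integral S a h ^ n * action_integral S a h"
    by (rule action_integral_mult_left[OF A, where \<phi> = h]) (rule inv)
  finally show ?case by (simp add: mult.commute)
qed

text \<open>
  Rotating a tuple of length \<open>p ^ m\<close> that many times gives it back, so rotation is a periodic map as above;
  its fixed points are the constant tuples.
\<close>

lemma action_integral_rotation_invariant:
  assumes p: "prime p" "of_nat p = (0::'k)" and A: "finitary_action V S a"
    and inv: "\<And>g xs. \<lbrakk>g \<in> V; xs \<in> tuples (p ^ m) S\<rbrakk> \<Longrightarrow> \<phi> (map (a g) xs) = \<phi> xs"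
    and rot: "\<And>xs. \<phi> (rotate1 xs) = \<phi> xs"
  shows "action_integral (tuples (p ^ m) S) (\<lambda>g. map (a g)) \<phi> = action_integral S a (\<lambda>x. \<phi> (replicate (p ^ m) x))"
proof -
  let ?q = "p ^ m"
  let ?Z = "tuples ?q S" and ?b = "\<lambda>g. map (a g)"
  have q: "?q > 0" using p(1) prime_gt_0_nat by simp
  have "action_integral ?Z ?b \<phi> = action_integral {xs \<in> ?Z. rotate1 xs = xs} ?b \<phi>"
  proof (rule action_integral_fixed_points[OF p finitary_tuples[OF A], where \<phi> = \<phi> and r = rotate1])
    show "\<And>g xs. \<lbrakk>g \<in> V; xs \<in> ?Z\<rbrakk> \<Longrightarrow> \<phi> (map (a g) xs) = \<phi> xs" by (rule inv)
    fix xs assume xs: "xs \<in> ?Z"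
    then show "rotate1 xs \<in> ?Z" by (simp add: tuples_def)
    have "rotate ?q xs = xs" using xs by (intro rotate_id) (simp add: tuples_def)
    then show "(rotate1 ^^ ?q) xs = xs" by (simp add: rotate_def)
  qed (simp_all add: rotate1_map rot)
  also have "{xs \<in> ?Z. rotate1 xs = xs} = replicate ?q ` S"
  proof (intro Set.set_eqI iffI)
    fix xs assume xs: "xs \<in> {xs \<in> ?Z. rotate1 xs = xs}"
    then have "xs \<noteq> []" using q by (auto simp: tuples_def)
    then have "card (set xs) = Suc 0" using rotate1_fixpoint_card xs by fastforce
    then obtain x where "xs = replicate (length xs) x" using card_set_1_iff_replicate by metis
    then have x: "xs = replicate ?q x" using xs by (simp add: tuples_def)
    then have "x \<in> S" using xs q by (auto simp: tuples_def)
    then show "xs \<in> replicate ?q ` S" using x by blast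
  next
    fix xs assume "xs \<in> replicate ?q ` S"
    then obtain x where x: "x \<in> S" "xs = replicate ?q x" by auto
    obtain n where "?q = Suc n" using q gr0_implies_Suc by blast
    then show "xs \<in> {xs \<in> ?Z. rotate1 xs = xs}"
      using x by (auto simp: tuples_def replicate_append_same)
  qed
  also have "action_integral (replicate ?q ` S) ?b \<phi> = action_integral S a (\<lambda>x. \<phi> (replicate ?q x))"
  proof (rule action_integral_image[OF A, where b = ?b and \<phi> = \<phi>])
    show "inj_on (replicate ?q) S" using q by (auto simp: inj_on_def)
    fix g y assume g: "g \<in> V" and y: "y \<in> S"
    show "map (a g) (replicate ?q y) = replicate ?q (a g y)" by simp
    show "\<phi> (replicate ?q (a g y)) = \<phi> (replicate ?q y)"
      using inv[OF g, of "replicate ?q y"] y by (simp add: tuples_def set_replicate_conv_if)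
  qed
  finally show ?thesis .
qed

section \<open>Powers and traces of matrices\<close>

text \<open>
  The invariance group contains \<open>V\<close>, hence is open and is a legitimate group of definition for the level
  sets.
\<close>

lemma hat_integral_eq_action_integral:
  fixes X :: "('g, 'x) hat_set"
  assumes X: "finitary_hat_set G T X" and V: "osub V" "V \<subseteq> defgrp X"
    and inv: "\<And>g x. \<lbrakk>g \<in> V; x \<in> points X\<rbrakk> \<Longrightarrow> \<phi> (act X g x) = \<phi> x"
  shows "hat_integral \<mu> X \<phi> = action_integral (points X) (act X) \<phi>"
proof -
  let ?S = "points X" and ?a = "act X" and ?I = "invariance_group X \<phi>"
  have A: "finitary_action (defgrp X) ?S ?a" by (rule finitary_action_hat[OF X])
  note D = finitary_actionD[OF A]
  have I: "osub ?I"
  proof (rule open_subgroup_mono[OF V(1)])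
    show "V \<subseteq> ?I" using V inv by (auto simp: invariance_group_def)
    show "subgroup ?I G"
    proof (rule subgroupI)
      show "?I \<subseteq> carrier G" using osub_carrier[OF D(1)] by (auto simp: invariance_group_def)
      show "?I \<noteq> {}" using osub_one[OF V(1)] \<open>V \<subseteq> ?I\<close> by auto
    next
      fix g assume "g \<in> ?I"
      then have g: "g \<in> defgrp X" "\<And>x. x \<in> ?S \<Longrightarrow> \<phi> (?a g x) = \<phi> x"
        by (auto simp: invariance_group_def)
      have i: "inv g \<in> defgrp X" using osub_inv[OF D(1) g(1)] .
      have "\<phi> (?a (inv g) x) = \<phi> x" if "x \<in> ?S" for x
        using g(2)[OF D(3)[OF i that]] action_inverse(2)[OF A g(1) that] by simp
      then show "inv g \<in> ?I" using i by (simp add: invariance_group_def)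
    next
      fix g h assume "g \<in> ?I" "h \<in> ?I"
      then show "g \<otimes> h \<in> ?I"
        using osub_mult[OF D(1)] D(3,4) by (auto simp: invariance_group_def)
    qed
  qed
  have AI: "finitary_action ?I ?S ?a"
    by (rule finitary_action_shrink[OF A I]) (auto simp: invariance_group_def)
  have "\<mu> (hat_sub X ?I {x \<in> ?S. \<phi> x = c}) = vol {x \<in> ?S. \<phi> x = c} ?a" for c
  proof -
    have L: "finitary_action ?I {x \<in> ?S. \<phi> x = c} ?a"
      by (rule finitary_level_set[OF AI]) (simp add: invariance_group_def)
    show ?thesis unfolding hat_sub_eq_hat_of
      by (rule vol_eq[OF L L I subset_refl subset_refl bij_betw_id, symmetric]) simp
  qed
  then have "hat_integral \<mu> X \<phi> = (\<Sum>c\<in>\<phi> ` ?S - {0}. c * vol {x \<in> ?S. \<phi> x = c} ?a)"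
    by (simp add: hat_integral_def)
  also have "\<dots> = action_integral ?S ?a \<phi>"
  proof -
    have "finite (\<phi> ` ?S)"
    proof (rule finite_image_factor[OF finitary_actionD(6)[OF AI]])
      fix x y assume "x \<in> ?S" "y \<in> ?S" "orb ?I ?a x = orb ?I ?a y"
      then have "x \<in> orb ?I ?a y" using orb_refl[OF AI] by metis
      then show "\<phi> x = \<phi> y" using \<open>y \<in> ?S\<close> by (auto simp: orb_def invariance_group_def)
    qed
    then show ?thesis unfolding action_integral_def by (intro sum.mono_neutral_left) auto
  qed
  finally show ?thesis .
qed

context
  fixes X :: "('g, 'x) hat_set" and V and A :: "'x \<times> 'x \<Rightarrow> 'k"
  assumes X: "finitary_hat_set G T X" and V: "osub V" "V \<subseteq> defgrp X"
    and A: "\<And>g x z. \<lbrakk>g \<in> V; x \<in> points X; z \<in> points X\<rbrakk> \<Longrightarrow> A (act X g x, act X g z) = A (x, z)"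
begin

lemma finitary_action_shrunk: "osub W \<Longrightarrow> W \<subseteq> V \<Longrightarrow> finitary_action W (points X) (act X)"
  using finitary_action_shrink[OF finitary_action_hat[OF X]] V by blast

text \<open>
  The base case says that the identity matrix is a left unit for \<open>A\<close>.  All integrands depend on the end
  points \<open>x\<close> and \<open>z\<close>, so the group of definition is cut down to their common stabilizer.
\<close>

lemma Mat_power_Suc:
  assumes "x \<in> points X" "z \<in> points X"
  shows "(A [^]\<^bsub>Mat G T \<mu> X\<^esub> Suc n) (x, z) =
    action_integral (tuples n (points X)) (\<lambda>g. map (act X g)) (\<lambda>ys. path_weight A x ys z)"
  using assms
proof (induction n arbitrary: x z)
  case (0 x z)
  let ?S = "points X" and ?a = "act X"
  let ?W = "stab V ?a x \<inter> stab V ?a z"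
  let ?f = "\<lambda>y. (if x = y then 1 else 0) * A (y, z)"
  have AV: "finitary_action V ?S ?a" using V by (intro finitary_action_shrunk) auto
  note D = finitary_actionD[OF AV]
  have W: "osub ?W" "?W \<subseteq> V" using D(5) 0 osub_Int by (auto simp: stab_def)
  have AW: "finitary_action ?W ?S ?a" using W by (rule finitary_action_shrunk)
  have eqx: "?a g y = x \<longleftrightarrow> y = x" if "g \<in> ?W" "y \<in> ?S" for g y
  proof
    have gx: "?a g x = x" using that by (simp add: stab_def)
    show "?a g y = x" if "y = x" using gx that by simp
    assume "?a g y = x"
    then show "y = x"
      using action_inverse(1)[OF AW that] action_inverse(1)[OF AW that(1) 0(1)] gx by simp
  qed
  have inv: "?f (?a g y) = ?f y" if "g \<in> ?W" "y \<in> ?S" for g y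
    using eqx[OF that] that by (auto simp: stab_def)
  have "(A [^]\<^bsub>Mat G T \<mu> X\<^esub> Suc 0) (x, z) =
      hat_integral \<mu> X (\<lambda>y. (\<lambda>(x, y)\<in>?S \<times> ?S. if x = y then 1 else 0) (x, y) * A (y, z))"
    using 0 by (simp add: Mat_def)
  also have "\<dots> = action_integral ?S ?a (\<lambda>y. (\<lambda>(x, y)\<in>?S \<times> ?S. if x = y then 1 else 0) (x, y) * A (y, z))"
    using inv W V 0 finitary_actionD(3)[OF AW] by (intro hat_integral_eq_action_integral[OF X W(1)]) auto
  also have "\<dots> = action_integral ?S ?a ?f" using 0 by (intro action_integral_cong) simp
  \<comment> \<open>The identity matrix is concentrated on the diagonal, so only the point \<open>x\<close> contributes.\<close>
  also have "\<dots> = action_integral ({x} \<union> (?S - {x})) ?a ?f" using 0 by (simp add: insert_absorb)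
  also have "\<dots> = action_integral {x} ?a ?f + action_integral (?S - {x}) ?a ?f"
  proof (rule action_integral_Un)
    show "finitary_action ?W ({x} \<union> (?S - {x})) ?a" using AW 0 by (simp add: insert_absorb)
    show "\<And>g y. \<lbrakk>g \<in> ?W; y \<in> {x}\<rbrakk> \<Longrightarrow> ?a g y \<in> {x}" by (simp add: stab_def)
    show "\<And>g y. \<lbrakk>g \<in> ?W; y \<in> ?S - {x}\<rbrakk> \<Longrightarrow> ?a g y \<in> ?S - {x}"
      using finitary_actionD(3)[OF AW] eqx by simp
    fix g y assume "g \<in> ?W" "y \<in> {x} \<union> (?S - {x})"
    then show "?f (?a g y) = ?f y" using 0 by (intro inv) auto
  qed simp
  also have "action_integral (?S - {x}) ?a ?f = 0" by (rule action_integral_zero) auto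
  also have "action_integral {x} ?a ?f = A (x, z)"
    using 0 finitary_action_subset[OF AW, of "{x}"]
    by (subst action_integral_trivial_action[of ?W]) (auto simp: stab_def)
  also have "A (x, z) + 0 = action_integral {[]} (\<lambda>g. map (?a g)) (\<lambda>ys. path_weight A x ys z)"
    using finitary_tuples[OF AW, of 0] unfolding tuples_0
    by (subst action_integral_trivial_action) auto
  finally show ?case by (simp add: tuples_0)
next
  case (Suc n x z)
  let ?S = "points X" and ?a = "act X"
  let ?W = "stab V ?a x \<inter> stab V ?a z"
  let ?J = "\<lambda>y. action_integral (tuples n ?S) (\<lambda>g. map (?a g)) (\<lambda>ys. path_weight A x (y # ys) z)"
  have AV: "finitary_action V ?S ?a" using V by (intro finitary_action_shrunk) auto
  note D = finitary_actionD[OF AV]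
  have W: "osub ?W" "?W \<subseteq> V" using D(5) Suc.prems osub_Int by (auto simp: stab_def)
  have AW: "finitary_action ?W ?S ?a" using W by (rule finitary_action_shrunk)
  have inv: "path_weight A x (map (?a g) ys) z = path_weight A x ys z"
    if g: "g \<in> ?W" and ys: "ys \<in> tuples (Suc n) ?S" for g ys
  proof -
    have "?a g x = x" "?a g z = z" "g \<in> V" using g by (auto simp: stab_def)
    then show ?thesis
      using path_weight_cong[of ?S A "?a g" x z ys] A Suc.prems ys by (auto simp: tuples_def)
  qed
  have J: "(A [^]\<^bsub>Mat G T \<mu> X\<^esub> Suc n) (x, y) * A (y, z) = ?J y" if y: "y \<in> ?S" for y
  proof -
    let ?U = "stab V ?a x \<inter> stab V ?a y"
    have U: "osub ?U" "?U \<subseteq> V" using D(5) Suc.prems y osub_Int by (auto simp: stab_def)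
    have "action_integral (tuples n ?S) (\<lambda>g. map (?a g)) (\<lambda>ys. A (y, z) * path_weight A x ys y) =
        A (y, z) * action_integral (tuples n ?S) (\<lambda>g. map (?a g)) (\<lambda>ys. path_weight A x ys y)"
    proof (rule action_integral_mult_left[OF finitary_tuples[OF finitary_action_shrunk[OF U]],
        where \<phi> = "\<lambda>ys. path_weight A x ys y"])
      fix g ys assume g: "g \<in> ?U" and ys: "ys \<in> tuples n ?S"
      then have "?a g x = x" "?a g y = y" "g \<in> V" by (auto simp: stab_def)
      then show "path_weight A x (map (?a g) ys) y = path_weight A x ys y"
        using path_weight_cong[of ?S A "?a g" x y ys] A Suc.prems y ys by (auto simp: tuples_def)
    qed
    then show ?thesis using Suc.IH[OF Suc.prems(1) y] by (simp add: mult.commute)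
  qed
  have Jinv: "?J (?a g y) = ?J y" if "g \<in> ?W" "y \<in> ?S" for g y
    using inv that by (rule action_integral_tuples_Suc(2)[OF AW, where \<phi> = "\<lambda>ys. path_weight A x ys z"])
  have "(A [^]\<^bsub>Mat G T \<mu> X\<^esub> Suc (Suc n)) (x, z) =
      hat_integral \<mu> X (\<lambda>y. (A [^]\<^bsub>Mat G T \<mu> X\<^esub> Suc n) (x, y) * A (y, z))"
    using Suc.prems by (simp add: Mat_def)
  also have "\<dots> = action_integral ?S ?a (\<lambda>y. (A [^]\<^bsub>Mat G T \<mu> X\<^esub> Suc n) (x, y) * A (y, z))"
    using Jinv J finitary_actionD(3)[OF AW] W V by (intro hat_integral_eq_action_integral[OF X W(1)]) auto
  also have "\<dots> = action_integral ?S ?a ?J" using J by (rule action_integral_cong)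
  also have "\<dots> = action_integral (tuples (Suc n) ?S) (\<lambda>g. map (?a g)) (\<lambda>ys. path_weight A x ys z)"
    using inv by (rule action_integral_tuples_Suc(1)[OF AW, where \<phi> = "\<lambda>ys. path_weight A x ys z", symmetric])
  finally show ?case .
qed

lemma cycle_weight_invariant:
  assumes "g \<in> V" "zs \<in> tuples (Suc n) (points X)"
  shows "cycle_weight A (map (act X g) zs) = cycle_weight A zs"
proof -
  obtain x ys where "zs = x # ys" "x \<in> points X" "set ys \<subseteq> points X"
    using assms(2) by (cases zs) (auto simp: tuples_def)
  then show ?thesis
    using path_weight_cong[of "points X" A "act X g" x x ys] A[OF assms(1)]
    by (simp add: cycle_weight_def)
qed

lemma mat_trace_power_Suc:
  "mat_trace \<mu> X (A [^]\<^bsub>Mat G T \<mu> X\<^esub> Suc n) =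
    action_integral (tuples (Suc n) (points X)) (\<lambda>g. map (act X g)) (cycle_weight A)"
proof -
  let ?S = "points X" and ?a = "act X"
  let ?J = "\<lambda>x. action_integral (tuples n ?S) (\<lambda>g. map (?a g)) (\<lambda>ys. cycle_weight A (x # ys))"
  have AV: "finitary_action V ?S ?a" using V by (intro finitary_action_shrunk) auto
  have J: "(A [^]\<^bsub>Mat G T \<mu> X\<^esub> Suc n) (x, x) = ?J x" if "x \<in> ?S" for x
    using Mat_power_Suc[OF that that] by (simp add: cycle_weight_def)
  have Jinv: "?J (?a g x) = ?J x" if "g \<in> V" "x \<in> ?S" for g x
    using cycle_weight_invariant that by (rule action_integral_tuples_Suc(2)[OF AV, where \<phi> = "cycle_weight A"])
  have "mat_trace \<mu> X (A [^]\<^bsub>Mat G T \<mu> X\<^esub> Suc n) =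
      action_integral ?S ?a (\<lambda>x. (A [^]\<^bsub>Mat G T \<mu> X\<^esub> Suc n) (x, x))"
    unfolding mat_trace_def
    using Jinv J finitary_actionD(3)[OF AV] by (intro hat_integral_eq_action_integral[OF X V]) simp
  also have "\<dots> = action_integral ?S ?a ?J" using J by (rule action_integral_cong)
  also have "\<dots> = action_integral (tuples (Suc n) ?S) (\<lambda>g. map (?a g)) (cycle_weight A)"
    using cycle_weight_invariant by (rule action_integral_tuples_Suc(1)[OF AV, where \<phi> = "cycle_weight A", symmetric])
  finally show ?thesis .
qed

text \<open>
  The cycle weight and the product of the diagonal entries are different rotation invariant
  functions on tuples, but on the constant tuple at \<open>x\<close> both equal \<open>A (x, x) ^ (p ^ m)\<close>.
\<close>

theorem mat_trace_frobenius:
  assumes p: "prime p" "of_nat p = (0::'k)"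
  shows "mat_trace \<mu> X (A [^]\<^bsub>Mat G T \<mu> X\<^esub> (p ^ m)) = mat_trace \<mu> X A ^ (p ^ m)"
proof -
  let ?S = "points X" and ?a = "act X" and ?h = "\<lambda>x. A (x, x)"
  have AV: "finitary_action V ?S ?a" using V by (intro finitary_action_shrunk) auto
  have "p ^ m > 0" using p(1) prime_gt_0_nat by simp
  then obtain n where n: "p ^ m = Suc n" using gr0_implies_Suc by blast
  have "mat_trace \<mu> X (A [^]\<^bsub>Mat G T \<mu> X\<^esub> (p ^ m)) =
      action_integral (tuples (p ^ m) ?S) (\<lambda>g. map (?a g)) (cycle_weight A)"
    unfolding n by (rule mat_trace_power_Suc)
  also have "\<dots> = action_integral ?S ?a (\<lambda>x. cycle_weight A (replicate (p ^ m) x))"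
    by (rule action_integral_rotation_invariant[OF p AV, where \<phi> = "cycle_weight A"]) (simp_all add: cycle_weight_rotate1 cycle_weight_invariant n)
  also have "\<dots> = action_integral ?S ?a (\<lambda>x. prod_list (map ?h (replicate (p ^ m) x)))"
    unfolding n by (simp add: cycle_weight_def path_weight_replicate map_replicate_const)
  also have "\<dots> = action_integral (tuples (p ^ m) ?S) (\<lambda>g. map (?a g)) (\<lambda>xs. prod_list (map ?h xs))"
  proof (rule action_integral_rotation_invariant[OF p AV, where \<phi> = "\<lambda>xs. prod_list (map ?h xs)", symmetric])
    fix g xs assume "g \<in> V" "xs \<in> tuples (p ^ m) ?S"
    then have "map ?h (map (?a g) xs) = map ?h xs" using A by (auto simp: tuples_def)
    then show "prod_list (map ?h (map (?a g) xs)) = prod_list (map ?h xs)" by (simp only:)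
  next
    fix xs
    show "prod_list (map ?h (rotate1 xs)) = prod_list (map ?h xs)"
      by (cases xs) (simp_all add: mult.commute)
  qed
  also have "\<dots> = action_integral ?S ?a ?h ^ (p ^ m)"
    by (rule action_integral_prod_list[OF AV, where h = ?h]) (simp add: A)
  also have "action_integral ?S ?a ?h = mat_trace \<mu> X A"
    unfolding mat_trace_def by (rule hat_integral_eq_action_integral[OF X V, symmetric]) (simp add: A)
  finally show ?thesis .
qed

end

end

lemma Mat_power_eq_zero:
  assumes "A [^]\<^bsub>Mat G T \<mu> X\<^esub> (n::nat) = \<zero>\<^bsub>Mat G T \<mu> X\<^esub>" and "n \<le> k"
  shows "A [^]\<^bsub>Mat G T \<mu> X\<^esub> k = \<zero>\<^bsub>Mat G T \<mu> X\<^esub>"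
  using assms(2)
proof (induction k rule: dec_induct)
  case (step k)
  have "hat_integral \<mu> X (\<lambda>y. \<zero>\<^bsub>Mat G T \<mu> X\<^esub> (x, y) * A (y, z)) = 0" if "x \<in> points X" for x z
    unfolding hat_integral_def using that by (intro sum.neutral) (auto simp: Mat_def)
  then have "\<zero>\<^bsub>Mat G T \<mu> X\<^esub> \<otimes>\<^bsub>Mat G T \<mu> X\<^esub> A = \<zero>\<^bsub>Mat G T \<mu> X\<^esub>"
    by (auto simp: Mat_def intro!: restrict_ext)
  then show ?case using step by simp
qed (rule assms(1))

theorem corollary7p9:
  fixes G :: "('g, 'm) monoid_scheme"
    and T :: "'g topology"
    and \<mu> :: "('g, 'x) hat_set \<Rightarrow> 'k::field"
    and X :: "('g, 'x) hat_set"
    and A :: "'x \<times> 'x \<Rightarrow> 'k"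
    and p :: nat
  assumes "pro_oligomorphic G T"
    and "large_universe G TYPE('x)"
    and "CHAR('k) = p" and "p > 0"
    and "hat_measure G T \<mu>"
    and "finitary_hat_set G T X"
    and "A \<in> carrier (Mat G T \<mu> X)"
    and "nilpotent (Mat G T \<mu> X) A"
  shows "mat_trace \<mu> X A = 0"
proof -
  interpret universal_measure G T \<mu>
    using assms(1,2,5) by (simp add: universal_measure_def universal_measure_axioms_def)
  have p: "prime p" "of_nat p = (0::'k)"
    using assms(3,4) prime_CHAR_semidom of_nat_CHAR by auto
  obtain V where V: "open_subgroup G T V" "V \<subseteq> defgrp X"
    and "invariant_under V (hat_prod X X) A"
    using assms(7) by (auto simp: Mat_def schwartz_def hat_prod_def)
  then have inv: "A (act X g x, act X g z) = A (x, z)"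
    if "g \<in> V" "x \<in> points X" "z \<in> points X" for g x z
    using that by (force simp: invariant_under_def hat_prod_def)
  obtain n where n: "A [^]\<^bsub>Mat G T \<mu> X\<^esub> (n::nat) = \<zero>\<^bsub>Mat G T \<mu> X\<^esub>"
    using assms(8) by (auto simp: nilpotent_def)
  \<comment> \<open>Any power of \<open>p\<close> beyond the nilpotency index will do.\<close>
  have "n \<le> p ^ n" using power_gt_expt[of p n] prime_gt_1_nat[OF p(1)] by simp
  then have "A [^]\<^bsub>Mat G T \<mu> X\<^esub> (p ^ n) = \<zero>\<^bsub>Mat G T \<mu> X\<^esub>"
    by (rule Mat_power_eq_zero[OF n])
  moreover have "mat_trace \<mu> X \<zero>\<^bsub>Mat G T \<mu> X\<^esub> = 0"
    unfolding mat_trace_def hat_integral_def by (intro sum.neutral) (auto simp: Mat_def)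
  ultimately have "mat_trace \<mu> X A ^ (p ^ n) = 0"
    using mat_trace_frobenius[where A = A and X = X and m = n, OF assms(6) V inv p] by simp
  then show ?thesis by simp
qed

end
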